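(* Let $\lambda_1,\lambda_2,\lambda_3,\lambda_4,\mu_1,\mu_2\in\mathbb{R}$ and let $(G,\varphi,\xi,\eta,g)$ be the 5-dimensional Lie group with left-invariant almost contact B-metric structure described in the context (it is an $\mathcal{F}_7$-manifold). Let $D$ be the $\varphi$KT-connection on it given by $D_xy=\nabla_xy+\frac12T(x,y)$ with torsion $T(x,y)=2\{\eta(x)\nabla_y\xi-\eta(y)\nabla_x\xi+(\nabla_x\eta)y\,\xi\}$, whose components are $$\begin{array}{ll} D_{E_1}E_1=-D_{E_3}E_3=\lambda_1E_2-\lambda_3E_4, & D_{E_1}E_2=-D_{E_3}E_4=-\lambda_1E_1+\lambda_3E_3,\\ D_{E_1}E_3=D_{E_3}E_1=\lambda_3E_2+\lambda_1E_4, & D_{E_1}E_4=D_{E_3}E_2=-\lambda_3E_1-\lambda_1E_3,\\ D_{E_2}E_1=-D_{E_4}E_3=\lambda_2E_2-\lambda_4E_4, & D_{E_2}E_2=-D_{E_4}E_4=-\lambda_2E_1+\lambda_4E_3,\\ D_{E_2}E_3=D_{E_4}E_1=\lambda_4E_2+\lambda_2E_4, & D_{E_2}E_4=D_{E_4}E_2=-\lambda_4E_1-\lambda_2E_3,\\ D_{E_5}E_1=-2\mu_1E_2+2\mu_2E_4, & D_{E_5}E_2=2\mu_1E_1-2\mu_2E_3,\\ D_{E_5}E_3=-2\mu_2E_2-2\mu_1E_4, & D_{E_5}E_4=2\mu_2E_1+2\mu_1E_3,\\ D_{E_i}E_5=0\ (i=1,\dots,5). & \end{array}$$ Then $D$ has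 a $D$-parallel torsion, i.e. $DT=0$.
   Context: $G$ is a 5-dimensional real connected Lie group whose Lie algebra has a basis $\{E_1,\dots,E_5\}$ of left-invariant vector fields with the only non-zero brackets (up to skew-symmetry) $[E_1,E_2]=-[E_3,E_4]=-\lambda_1E_1-\lambda_2E_2+\lambda_3E_3+\lambda_4E_4+2\mu_1E_5$ and $[E_1,E_4]=-[E_2,E_3]=-\lambda_3E_1-\lambda_4E_2-\lambda_1E_3-\lambda_2E_4+2\mu_2E_5$. The left-invariant structure is: $\varphi E_1=E_3$, $\varphi E_2=E_4$, $\varphi E_3=-E_1$, $\varphi E_4=-E_2$, $\varphi E_5=0$; $\xi=E_5$; $\eta(E_i)=0$ for $i\le4$, $\eta(E_5)=1$; $g(E_1,E_1)=g(E_2,E_2)=-g(E_3,E_3)=-g(E_4,E_4)=g(E_5,E_5)=1$, $g(E_i,E_j)=0$ for $i\ne j$. $\nabla$ is the Levi-Civita connection of $g$. A $\varphi$KT-connection is a linear connection $D$ with $D\varphi=0$, $D\xi=0$, $D\eta=0$, $Dg=0$ whose torsion $T(x,y)=D_xy-D_yx-[x,y]$ is such that $T(x,y,z)=g(T(x,y),z)$ is totally skew-symmetric. An $\mathcal{F}_7$-manifold is one for which $F(x,y,z)=g((\nabla_x\varphi)y,z)$ satisfies $F(x,y,z)+F(y,z,x)+F(z,x,y)=0$ and $F(x,y,z)=-F(\varphi x,\varphi y,z)-F(\varphi x,y,\varphi z)$. *)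

theory Defs
  imports "HOL-Analysis.Analysis" "HOL-Library.Function_Algebras"
begin

section \<open>Smooth manifolds\<close>

text \<open>All uses of the following two notions below are on open sets, where differentiability
  within the set and at its points coincide.\<close>

primrec Ck_on ::
  "nat \<Rightarrow> 'e::real_normed_vector set \<Rightarrow> ('e \<Rightarrow> 'f::real_normed_vector) \<Rightarrow> bool" where
  "Ck_on 0 S f \<longleftrightarrow> continuous_on S f"
| "Ck_on (Suc k) S f \<longleftrightarrow>
     f differentiable_on S \<and> (\<forall>v. Ck_on k S (\<lambda>x. frechet_derivative f (at x) v))"

definition smooth_on ::
  "'e::real_normed_vector set \<Rightarrow> ('e \<Rightarrow> 'f::real_normed_vector) \<Rightarrow> bool" where
  "smooth_on S f \<longleftrightarrow> (\<forall>k. Ck_on k S f)"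

text \<open>A chart is a pair \<open>(U, \<phi>)\<close>; only the restriction of \<open>\<phi>\<close> to \<open>U\<close> is relevant, and its
  inverse is \<open>inv_into U \<phi>\<close>. Atlases are not required to be maximal.\<close>

type_synonym ('a, 'e) chart = "'a set \<times> ('a \<Rightarrow> 'e)"

definition is_chart :: "('a::topological_space, 'e::euclidean_space) chart \<Rightarrow> bool" where
  "is_chart = (\<lambda>(U, \<phi>).
     open U \<and> open (\<phi> ` U) \<and> homeomorphism U (\<phi> ` U) \<phi> (inv_into U \<phi>))"

definition smooth_atlas :: "('a::topological_space, 'e::euclidean_space) chart set \<Rightarrow> bool" where
  "smooth_atlas A \<longleftrightarrow>
     (\<forall>c\<in>A. is_chart c) \<and> (\<Union>(U, \<phi>)\<in>A. U) = UNIV \<and>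
     (\<forall>(U, \<phi>)\<in>A. \<forall>(V, \<psi>)\<in>A. smooth_on (\<phi> ` (U \<inter> V)) (\<psi> \<circ> inv_into U \<phi>))"

definition smooth_map ::
  "('a::topological_space, 'e::euclidean_space) chart set \<Rightarrow>
   ('b::topological_space, 'f::euclidean_space) chart set \<Rightarrow> ('a \<Rightarrow> 'b) \<Rightarrow> bool" where
  "smooth_map A B h \<longleftrightarrow> continuous_on UNIV h \<and>
     (\<forall>(U, \<phi>)\<in>A. \<forall>(V, \<psi>)\<in>B. smooth_on (\<phi> ` (U \<inter> h -` V)) (\<psi> \<circ> h \<circ> inv_into U \<phi>))"

definition prod_atlas ::
  "('a, 'e) chart set \<Rightarrow> ('b, 'f) chart set \<Rightarrow> ('a \<times> 'b, 'e \<times> 'f) chart set" where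
  "prod_atlas A B = {(U \<times> V, map_prod \<phi> \<psi>) | U \<phi> V \<psi>. (U, \<phi>) \<in> A \<and> (V, \<psi>) \<in> B}"

definition smooth_functions ::
  "('a::topological_space, 'e::euclidean_space) chart set \<Rightarrow> ('a \<Rightarrow> real) set" where
  "smooth_functions A = {f. \<forall>(U, \<phi>)\<in>A. smooth_on (\<phi> ` U) (f \<circ> inv_into U \<phi>)}"

section \<open>Vector fields\<close>

text \<open>A tangent vector at \<open>p\<close> is a directional derivative, in some chart around \<open>p\<close>, acting on
  smooth functions. It is set to \<open>0\<close> on non-smooth functions, so that tangent vectors are
  equal iff they agree on smooth functions.\<close>

definition tangent_space ::
  "('a::topological_space, 'e::euclidean_space) chart set \<Rightarrow> 'a \<Rightarrow> (('a \<Rightarrow> real) \<Rightarrow> real) set" where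
  "tangent_space A p = {v. \<exists>(U, \<phi>)\<in>A. p \<in> U \<and> (\<exists>u. v = (\<lambda>f.
     if f \<in> smooth_functions A then frechet_derivative (f \<circ> inv_into U \<phi>) (at (\<phi> p)) u else 0))}"

type_synonym 'a vfield = "'a \<Rightarrow> ('a \<Rightarrow> real) \<Rightarrow> real"

definition vector_fields ::
  "('a::topological_space, 'e::euclidean_space) chart set \<Rightarrow> 'a vfield set" where
  "vector_fields A = {X. (\<forall>p. X p \<in> tangent_space A p) \<and>
     (\<forall>f\<in>smooth_functions A. (\<lambda>p. X p f) \<in> smooth_functions A)}"

text \<open>Sums, differences and zero of vector fields and of functions are the pointwise ones.\<close>

definition fscale :: "('a \<Rightarrow> real) \<Rightarrow> 'a vfield \<Rightarrow> 'a vfield" (infixr "\<odot>" 75) where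
  "h \<odot> X = (\<lambda>p f. h p * X p f)"

definition cscale :: "real \<Rightarrow> 'a vfield \<Rightarrow> 'a vfield" (infixr "\<cdot>" 75) where
  "c \<cdot> X = (\<lambda>_. c) \<odot> X"

definition dir :: "'a vfield \<Rightarrow> ('a \<Rightarrow> real) \<Rightarrow> ('a \<Rightarrow> real)" where
  "dir X f = (\<lambda>p. X p f)"

definition bracket :: "'a vfield \<Rightarrow> 'a vfield \<Rightarrow> 'a vfield" where
  "bracket X Y = (\<lambda>p f. X p (dir Y f) - Y p (dir X f))"

section \<open>Lie groups\<close>

locale lie_group = group mul one inv
  for mul :: "'a::{t2_space, second_countable_topology} \<Rightarrow> 'a \<Rightarrow> 'a"
    and one :: 'a and inv :: "'a \<Rightarrow> 'a" +
  fixes A :: "('a, 'e::euclidean_space) chart set"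
  assumes atlas: "smooth_atlas A"
    and smooth_mul: "smooth_map (prod_atlas A A) A (\<lambda>(a, b). mul a b)"
    and smooth_inv: "smooth_map A A inv"

definition lie_algebra ::
  "('a::topological_space, 'e::euclidean_space) chart set \<Rightarrow> ('a \<Rightarrow> 'a \<Rightarrow> 'a) \<Rightarrow> 'a vfield set" where
  "lie_algebra A mul = {X \<in> vector_fields A.
     \<forall>a p. \<forall>f\<in>smooth_functions A. X (mul a p) f = X p (f \<circ> mul a)}"

definition real_basis :: "'a vfield set \<Rightarrow> nat set \<Rightarrow> (nat \<Rightarrow> 'a vfield) \<Rightarrow> bool" where
  "real_basis V I E \<longleftrightarrow>
     (\<forall>i\<in>I. E i \<in> V) \<and>
     (\<forall>c. (\<Sum>i\<in>I. c i \<cdot> E i) = 0 \<longrightarrow> (\<forall>i\<in>I. c i = 0)) \<and>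
     (\<forall>X\<in>V. \<exists>c. X = (\<Sum>i\<in>I. c i \<cdot> E i))"

section \<open>Tensor fields\<close>

text \<open>Tensor fields are maps on vector fields that are linear over the smooth functions.\<close>

definition one_form ::
  "('a::topological_space, 'e::euclidean_space) chart set \<Rightarrow> ('a vfield \<Rightarrow> 'a \<Rightarrow> real) \<Rightarrow> bool" where
  "one_form A \<eta> \<longleftrightarrow>
     (\<forall>X\<in>vector_fields A. \<eta> X \<in> smooth_functions A) \<and>
     (\<forall>X\<in>vector_fields A. \<forall>Y\<in>vector_fields A. \<eta> (X + Y) = \<eta> X + \<eta> Y) \<and>
     (\<forall>X\<in>vector_fields A. \<forall>h\<in>smooth_functions A. \<eta> (h \<odot> X) = h * \<eta> X)"

definition endo_field ::
  "('a::topological_space, 'e::euclidean_space) chart set \<Rightarrow> ('a vfield \<Rightarrow> 'a vfield) \<Rightarrow> bool" where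
  "endo_field A \<phi> \<longleftrightarrow>
     (\<forall>X\<in>vector_fields A. \<phi> X \<in> vector_fields A) \<and>
     (\<forall>X\<in>vector_fields A. \<forall>Y\<in>vector_fields A. \<phi> (X + Y) = \<phi> X + \<phi> Y) \<and>
     (\<forall>X\<in>vector_fields A. \<forall>h\<in>smooth_functions A. \<phi> (h \<odot> X) = h \<odot> \<phi> X)"

definition pseudo_riemannian ::
  "('a::topological_space, 'e::euclidean_space) chart set \<Rightarrow>
   ('a vfield \<Rightarrow> 'a vfield \<Rightarrow> 'a \<Rightarrow> real) \<Rightarrow> bool" where
  "pseudo_riemannian A g \<longleftrightarrow>
     (\<forall>X\<in>vector_fields A. one_form A (g X)) \<and>
     (\<forall>X\<in>vector_fields A. \<forall>Y\<in>vector_fields A. g X Y = g Y X) \<and>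
     (\<forall>X\<in>vector_fields A. \<forall>p. (\<forall>Y\<in>vector_fields A. g X Y p = 0) \<longrightarrow> X p = 0)"

definition almost_contact_B_metric ::
  "('a::topological_space, 'e::euclidean_space) chart set \<Rightarrow> ('a vfield \<Rightarrow> 'a vfield) \<Rightarrow>
   'a vfield \<Rightarrow> ('a vfield \<Rightarrow> 'a \<Rightarrow> real) \<Rightarrow> ('a vfield \<Rightarrow> 'a vfield \<Rightarrow> 'a \<Rightarrow> real) \<Rightarrow> bool" where
  "almost_contact_B_metric A \<phi> \<xi> \<eta> g \<longleftrightarrow>
     endo_field A \<phi> \<and> \<xi> \<in> vector_fields A \<and> one_form A \<eta> \<and> pseudo_riemannian A g \<and>
     \<phi> \<xi> = 0 \<and> \<eta> \<xi> = 1 \<and>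
     (\<forall>X\<in>vector_fields A. \<phi> (\<phi> X) = \<eta> X \<odot> \<xi> - X) \<and>
     (\<forall>X\<in>vector_fields A. \<eta> (\<phi> X) = 0) \<and>
     (\<forall>X\<in>vector_fields A. \<forall>Y\<in>vector_fields A. g (\<phi> X) (\<phi> Y) = \<eta> X * \<eta> Y - g X Y)"

section \<open>Linear connections\<close>

definition linear_connection ::
  "('a::topological_space, 'e::euclidean_space) chart set \<Rightarrow>
   ('a vfield \<Rightarrow> 'a vfield \<Rightarrow> 'a vfield) \<Rightarrow> bool" where
  "linear_connection A D \<longleftrightarrow>
     (\<forall>Y\<in>vector_fields A. endo_field A (\<lambda>X. D X Y)) \<and>
     (\<forall>X\<in>vector_fields A. \<forall>Y\<in>vector_fields A. \<forall>Z\<in>vector_fields A.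
        D X (Y + Z) = D X Y + D X Z) \<and>
     (\<forall>X\<in>vector_fields A. \<forall>Y\<in>vector_fields A. \<forall>h\<in>smooth_functions A.
        D X (h \<odot> Y) = dir X h \<odot> Y + h \<odot> D X Y)"

definition torsion ::
  "('a vfield \<Rightarrow> 'a vfield \<Rightarrow> 'a vfield) \<Rightarrow> 'a vfield \<Rightarrow> 'a vfield \<Rightarrow> 'a vfield" where
  "torsion D X Y = D X Y - D Y X - bracket X Y"

text \<open>In the following covariant derivatives the direction is the first vector field.\<close>

definition cov_endo ::
  "('a vfield \<Rightarrow> 'a vfield \<Rightarrow> 'a vfield) \<Rightarrow> ('a vfield \<Rightarrow> 'a vfield) \<Rightarrow>
   'a vfield \<Rightarrow> 'a vfield \<Rightarrow> 'a vfield" where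
  "cov_endo D \<phi> X Y = D X (\<phi> Y) - \<phi> (D X Y)"

definition cov_form ::
  "('a vfield \<Rightarrow> 'a vfield \<Rightarrow> 'a vfield) \<Rightarrow> ('a vfield \<Rightarrow> 'a \<Rightarrow> real) \<Rightarrow>
   'a vfield \<Rightarrow> 'a vfield \<Rightarrow> 'a \<Rightarrow> real" where
  "cov_form D \<eta> X Y = dir X (\<eta> Y) - \<eta> (D X Y)"

definition cov_metric ::
  "('a vfield \<Rightarrow> 'a vfield \<Rightarrow> 'a vfield) \<Rightarrow> ('a vfield \<Rightarrow> 'a vfield \<Rightarrow> 'a \<Rightarrow> real) \<Rightarrow>
   'a vfield \<Rightarrow> 'a vfield \<Rightarrow> 'a vfield \<Rightarrow> 'a \<Rightarrow> real" where
  "cov_metric D g X Y Z = dir X (g Y Z) - g (D X Y) Z - g Y (D X Z)"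

definition cov_tensor21 ::
  "('a vfield \<Rightarrow> 'a vfield \<Rightarrow> 'a vfield) \<Rightarrow> ('a vfield \<Rightarrow> 'a vfield \<Rightarrow> 'a vfield) \<Rightarrow>
   'a vfield \<Rightarrow> 'a vfield \<Rightarrow> 'a vfield \<Rightarrow> 'a vfield" where
  "cov_tensor21 D T X Y Z = D X (T Y Z) - T (D X Y) Z - T Y (D X Z)"

definition levi_civita ::
  "('a::topological_space, 'e::euclidean_space) chart set \<Rightarrow>
   ('a vfield \<Rightarrow> 'a vfield \<Rightarrow> 'a \<Rightarrow> real) \<Rightarrow> ('a vfield \<Rightarrow> 'a vfield \<Rightarrow> 'a vfield) \<Rightarrow> bool" where
  "levi_civita A g N \<longleftrightarrow> linear_connection A N \<and>
     (\<forall>X\<in>vector_fields A. \<forall>Y\<in>vector_fields A. torsion N X Y = 0) \<and>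
     (\<forall>X\<in>vector_fields A. \<forall>Y\<in>vector_fields A. \<forall>Z\<in>vector_fields A. cov_metric N g X Y Z = 0)"

section \<open>The class F7 and connections with skew torsion\<close>

definition F_tensor ::
  "('a vfield \<Rightarrow> 'a vfield) \<Rightarrow> ('a vfield \<Rightarrow> 'a vfield \<Rightarrow> 'a \<Rightarrow> real) \<Rightarrow>
   ('a vfield \<Rightarrow> 'a vfield \<Rightarrow> 'a vfield) \<Rightarrow> 'a vfield \<Rightarrow> 'a vfield \<Rightarrow> 'a vfield \<Rightarrow> 'a \<Rightarrow> real" where
  "F_tensor \<phi> g N X Y Z = g (cov_endo N \<phi> X Y) Z"

definition F7_manifold ::
  "('a::topological_space, 'e::euclidean_space) chart set \<Rightarrow> ('a vfield \<Rightarrow> 'a vfield) \<Rightarrow>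
   ('a vfield \<Rightarrow> 'a vfield \<Rightarrow> 'a \<Rightarrow> real) \<Rightarrow> ('a vfield \<Rightarrow> 'a vfield \<Rightarrow> 'a vfield) \<Rightarrow> bool" where
  "F7_manifold A \<phi> g N \<longleftrightarrow> (let F = F_tensor \<phi> g N in
     \<forall>X\<in>vector_fields A. \<forall>Y\<in>vector_fields A. \<forall>Z\<in>vector_fields A.
       F X Y Z + F Y Z X + F Z X Y = 0 \<and>
       F X Y Z = - F (\<phi> X) (\<phi> Y) Z - F (\<phi> X) Y (\<phi> Z))"

definition phiKT_connection ::
  "('a::topological_space, 'e::euclidean_space) chart set \<Rightarrow> ('a vfield \<Rightarrow> 'a vfield) \<Rightarrow>
   'a vfield \<Rightarrow> ('a vfield \<Rightarrow> 'a \<Rightarrow> real) \<Rightarrow> ('a vfield \<Rightarrow> 'a vfield \<Rightarrow> 'a \<Rightarrow> real) \<Rightarrow>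
   ('a vfield \<Rightarrow> 'a vfield \<Rightarrow> 'a vfield) \<Rightarrow> bool" where
  "phiKT_connection A \<phi> \<xi> \<eta> g D \<longleftrightarrow> linear_connection A D \<and>
     (\<forall>X\<in>vector_fields A. \<forall>Y\<in>vector_fields A. cov_endo D \<phi> X Y = 0) \<and>
     (\<forall>X\<in>vector_fields A. D X \<xi> = 0) \<and>
     (\<forall>X\<in>vector_fields A. \<forall>Y\<in>vector_fields A. cov_form D \<eta> X Y = 0) \<and>
     (\<forall>X\<in>vector_fields A. \<forall>Y\<in>vector_fields A. \<forall>Z\<in>vector_fields A. cov_metric D g X Y Z = 0) \<and>
     (let T = (\<lambda>X Y Z. g (torsion D X Y) Z) in
      \<forall>X\<in>vector_fields A. \<forall>Y\<in>vector_fields A. \<forall>Z\<in>vector_fields A.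
        T X Y Z = - T Y X Z \<and> T X Y Z = - T X Z Y)"

end

theory Submission
  imports Defs
begin

text \<open>A left-invariant field vanishing at one point vanishes everywhere, so the \<open>E i\<close> span every
  tangent space; as they are orthonormal, every vector field is a combination of them with smooth
  coefficients, and a tensor identity only has to be checked on the \<open>E i\<close>. Koszul's formula shows
  that \<open>P X = \<nabla>\<^bsub>X\<^esub>\<xi>\<close> is skew, that is, \<open>\<xi>\<close> is Killing, so
  \<open>T(X, Y) = 2 (\<eta>(X) P Y - \<eta>(Y) P X + g(P X, Y) \<xi>)\<close> is totally skew and \<open>\<eta>\<close>, \<open>\<xi>\<close> and \<open>g\<close> are
  \<open>D\<close>-parallel. On the frame one finds \<open>D\<phi> = 0\<close>, \<open>P\<phi> = \<phi>P\<close> and \<open>DP = 0\<close>; the first two give the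
  class F7, the last gives \<open>DT = 0\<close>.\<close>

section \<open>Smooth functions\<close>

text \<open>Tensor fields are constrained only on global fields and global smooth functions, so a
  value at a single point cannot be fed into \<open>g\<close> or \<open>D\<close>. An expansion in
  the frame is of use only once its coefficients are smooth on the whole group. Orthogonality
  supplies the candidates \<open>g X (E i) / \<epsilon> i\<close>. That nothing is left over is the
  real obstacle; Cramer's rule overcomes it, writing a multiple of the remainder, by a function that
  does not vanish at a given point, as a combination with globally smooth coefficients.

  DP = 0 has a structural reason. On the span of E1, ..., E4 the tensor \<open>\<phi>\<close> is a
  complex structure and \<open>g\<close> is the real part of a complex bilinear form for which E1,
  E2 are orthonormal. The matrices of D along the frame and of P are skew and commute with
  \<open>\<phi>\<close>, so on this span they lie in so(2, C), which is one-dimensional over C and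
  hence abelian. As all coefficients are constant, DP = 0 says just that these matrices
  commute.\<close>

lemma Ck_on_cong:
  assumes "open S" "\<And>x. x \<in> S \<Longrightarrow> f x = g x" "Ck_on k S f"
  shows "Ck_on k S g"
  using assms(2,3)
proof (induction k arbitrary: f g)
  case 0
  then show ?case using continuous_on_cong[of S S f g] by simp
next
  case (Suc k)
  have diff: "f differentiable at x" if "x \<in> S" for x
    using Suc.prems(2) assms(1) that differentiable_on_eq_differentiable_at by auto
  have fg: "frechet_derivative f (at x) v = frechet_derivative g (at x) v" if "x \<in> S" for x v
    using frechet_derivative_transform_within_open[OF diff[OF that] assms(1) that] Suc.prems(1) by simp
  have "g differentiable at x within S" if "x \<in> S" for x
    using differentiable_transform_within[of f x S 1 g] Suc.prems that
    by (simp add: differentiable_on_def)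
  moreover have "Ck_on k S (\<lambda>x. frechet_derivative g (at x) v)" for v
    using Suc.IH[OF fg] Suc.prems(2) by simp
  ultimately show ?case by (simp add: differentiable_on_def)
qed

lemma Ck_on_SucD: "Ck_on (Suc k) S f \<Longrightarrow> Ck_on k S f"
proof (induction k arbitrary: f)
  case 0
  then show ?case by (auto intro: differentiable_imp_continuous_on)
next
  case (Suc k)
  then show ?case by (metis Ck_on.simps(2))
qed

lemma Ck_on_const: "Ck_on k S (\<lambda>_. c)"
  by (induction k arbitrary: c) auto

lemma Ck_on_add:
  assumes "open S" "Ck_on k S f" "Ck_on k S g"
  shows "Ck_on k S (\<lambda>x. f x + g x)"
  using assms(2,3)
proof (induction k arbitrary: f g)
  case 0
  then show ?case by (auto intro: continuous_on_add)
next
  case (Suc k)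
  have d: "frechet_derivative f (at x) v + frechet_derivative g (at x) v
      = frechet_derivative (\<lambda>x. f x + g x) (at x) v" if "x \<in> S" for x v
  proof -
    have "f differentiable at x" "g differentiable at x"
      using Suc.prems assms(1) that differentiable_on_eq_differentiable_at by auto
    then have "((\<lambda>x. f x + g x) has_derivative
        (\<lambda>v. frechet_derivative f (at x) v + frechet_derivative g (at x) v)) (at x)"
      by (intro has_derivative_add) (auto simp: frechet_derivative_works[symmetric])
    from fun_cong[OF frechet_derivative_at[OF this]] show ?thesis .
  qed
  have "Ck_on k S (\<lambda>x. frechet_derivative f (at x) v + frechet_derivative g (at x) v)" for v
    using Suc by auto
  then show ?case
    using Suc.prems Ck_on_cong[OF assms(1) d] by (auto intro: differentiable_on_add)
qed

lemma Ck_on_mult: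
  fixes f g :: "'e::real_normed_vector \<Rightarrow> 'f::real_normed_algebra"
  assumes "open S" "Ck_on k S f" "Ck_on k S g"
  shows "Ck_on k S (\<lambda>x. f x * g x)"
  using assms(2,3)
proof (induction k arbitrary: f g)
  case 0
  then show ?case by (auto intro: continuous_on_mult)
next
  case (Suc k)
  have d: "f x * frechet_derivative g (at x) v + frechet_derivative f (at x) v * g x
      = frechet_derivative (\<lambda>x. f x * g x) (at x) v" if "x \<in> S" for x v
  proof -
    have "f differentiable at x" "g differentiable at x"
      using Suc.prems assms(1) that differentiable_on_eq_differentiable_at by auto
    then have "((\<lambda>x. f x * g x) has_derivative
        (\<lambda>v. f x * frechet_derivative g (at x) v + frechet_derivative f (at x) v * g x)) (at x)"
      by (intro has_derivative_mult) (auto simp: frechet_derivative_works[symmetric])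
    from fun_cong[OF frechet_derivative_at[OF this]] show ?thesis .
  qed
  \<comment> \<open>By Leibniz the derivative still contains f and g themselves, so both orders
    \<open>k\<close> and \<open>Suc k\<close> of them are used.\<close>
  have "Ck_on k S (\<lambda>x. f x * frechet_derivative g (at x) v + frechet_derivative f (at x) v * g x)" for v
    using Suc Ck_on_SucD[OF Suc.prems(1)] Ck_on_SucD[OF Suc.prems(2)]
    by (auto intro!: Ck_on_add[OF assms(1)])
  moreover have "(\<lambda>x. f x * g x) differentiable_on S"
    using Suc.prems by (auto intro: differentiable_on_mult)
  ultimately show ?case
    using Ck_on_cong[OF assms(1) d] by auto
qed

text \<open>The last clause makes images of chart overlaps open, so that differentiability on such
  an image is differentiability at each of its points.\<close>

lemma is_chartD:
  assumes "is_chart (U, \<phi>)"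
  shows "open U" "open (\<phi> ` U)" "p \<in> U \<Longrightarrow> inv_into U \<phi> (\<phi> p) = p"
    "inj_on \<phi> U" "open W \<Longrightarrow> open (\<phi> ` (U \<inter> W))"
proof -
  show o: "open U" "open (\<phi> ` U)" using assms by (auto simp: is_chart_def)
  have h: "homeomorphism U (\<phi> ` U) \<phi> (inv_into U \<phi>)" using assms by (auto simp: is_chart_def)
  show "inv_into U \<phi> (\<phi> p) = p" if "p \<in> U" for p
    using h that by (auto simp: homeomorphism_def)
  then show "inj_on \<phi> U" by (rule inj_on_inverseI)
  show "open (\<phi> ` (U \<inter> W))" if "open W"
    using homeomorphism_imp_open_map[OF h openin_open_Int[OF that]] o(2)
    by (simp add: openin_open_eq)
qed

section \<open>The algebra of smooth functions on a manifold\<close>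

locale smooth_manifold =
  fixes A :: "('a::topological_space, 'e::euclidean_space) chart set"
  assumes smooth_atlas: "smooth_atlas A"
begin

lemma chart: "(U, \<phi>) \<in> A \<Longrightarrow> is_chart (U, \<phi>)"
  using smooth_atlas by (auto simp: smooth_atlas_def)

lemma obtain_chart: obtains U \<phi> where "(U, \<phi>) \<in> A" "p \<in> U"
  using smooth_atlas unfolding smooth_atlas_def by blast

lemma smooth_functions_iff:
  "f \<in> smooth_functions A \<longleftrightarrow>
     (\<forall>U \<phi> k. (U, \<phi>) \<in> A \<longrightarrow> Ck_on k (\<phi> ` U) (\<lambda>x. f (inv_into U \<phi> x)))"
  by (auto simp: smooth_functions_def smooth_on_def comp_def)

lemma smooth_const [simp]: "(\<lambda>_. c) \<in> smooth_functions A"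
  by (simp add: smooth_functions_iff Ck_on_const)

lemma smooth_zero [simp]: "0 \<in> smooth_functions A" and smooth_one [simp]: "1 \<in> smooth_functions A"
  using smooth_const[of 0] smooth_const[of 1] by (simp_all add: zero_fun_def one_fun_def)

lemma smooth_add [simp]:
  "f \<in> smooth_functions A \<Longrightarrow> h \<in> smooth_functions A \<Longrightarrow> f + h \<in> smooth_functions A"
  by (simp add: smooth_functions_iff Ck_on_add is_chartD(2)[OF chart])

lemma smooth_mult [simp]:
  "f \<in> smooth_functions A \<Longrightarrow> h \<in> smooth_functions A \<Longrightarrow> f * h \<in> smooth_functions A"
  by (simp add: smooth_functions_iff Ck_on_mult is_chartD(2)[OF chart])

lemma smooth_sum:
  "(\<And>i. i \<in> I \<Longrightarrow> f i \<in> smooth_functions A) \<Longrightarrow> (\<Sum>i\<in>I. f i) \<in> smooth_functions A"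
  by (induction I rule: infinite_finite_induct) auto

lemma smooth_prod:
  "(\<And>i. i \<in> I \<Longrightarrow> f i \<in> smooth_functions A) \<Longrightarrow> (\<Prod>i\<in>I. f i) \<in> smooth_functions A"
  by (induction I rule: infinite_finite_induct) auto

lemma smooth_differentiable:
  assumes "f \<in> smooth_functions A" "(U, \<phi>) \<in> A" "p \<in> U"
  shows "(f \<circ> inv_into U \<phi>) differentiable at (\<phi> p)"
proof -
  have "Ck_on (Suc 0) (\<phi> ` U) (f \<circ> inv_into U \<phi>)"
    using assms unfolding smooth_functions_def smooth_on_def by blast
  then show ?thesis
    using differentiable_on_eq_differentiable_at[OF is_chartD(2)[OF chart[OF assms(2)]]] assms(3)
    by auto
qed

section \<open>Tangent vectors and vector fields\<close>

text \<open>The vectors occurring in \<open>tangent_space\<close>, as a function of the direction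
  \<open>u\<close>, so that linearity in \<open>u\<close> can be exploited. The default 0 on
  non-smooth functions is the one chosen there.\<close>

definition chart_vector :: "('a, 'e) chart \<Rightarrow> 'a \<Rightarrow> 'e \<Rightarrow> ('a \<Rightarrow> real) \<Rightarrow> real" where
  "chart_vector = (\<lambda>(U, \<phi>) p u f.
     if f \<in> smooth_functions A then frechet_derivative (f \<circ> inv_into U \<phi>) (at (\<phi> p)) u else 0)"

lemma tangent_space_chart_vector:
  "v \<in> tangent_space A p \<longleftrightarrow> (\<exists>c\<in>A. p \<in> fst c \<and> (\<exists>u. v = chart_vector c p u))"
  unfolding tangent_space_def chart_vector_def by (auto simp: split_beta)

lemma linear_chart_vector:
  assumes "(U, \<phi>) \<in> A" "p \<in> U"
  shows "linear (\<lambda>u. chart_vector (U, \<phi>) p u f)"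
proof (cases "f \<in> smooth_functions A")
  case True
  then show ?thesis
    using linear_frechet_derivative[OF smooth_differentiable[OF True assms]]
    by (simp add: chart_vector_def)
next
  case False
  then show ?thesis by (simp add: chart_vector_def module_hom_zero)
qed

text \<open>Chain rule: the Jacobian of the transition map carries directions in one chart to
  directions in the other. It is needed because \<open>tangent_space\<close> lets every vector
  choose its own chart, so two vectors to be added may come from different ones.\<close>

lemma chart_vector_change:
  assumes c: "(U, \<phi>) \<in> A" "p \<in> U" and d: "(V, \<psi>) \<in> A" "p \<in> V"
  shows "\<exists>w. chart_vector (V, \<psi>) p u = chart_vector (U, \<phi>) p w"
proof -
  let ?t = "\<phi> \<circ> inv_into V \<psi>"
  define J where "J = frechet_derivative ?t (at (\<psi> p))"
  have o: "open (\<psi> ` (V \<inter> U))"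
    using is_chartD(5)[OF chart[OF d(1)]] is_chartD(1)[OF chart[OF c(1)]] by blast
  have "Ck_on (Suc 0) (\<psi> ` (V \<inter> U)) ?t"
    using smooth_atlas c(1) d(1) unfolding smooth_atlas_def smooth_on_def by blast
  then have "?t differentiable at (\<psi> p)"
    using differentiable_on_eq_differentiable_at[OF o] c(2) d(2) by auto
  then have J: "(?t has_derivative J) (at (\<psi> p))"
    by (simp add: J_def frechet_derivative_works[symmetric])
  have tp: "?t (\<psi> p) = \<phi> p"
    using is_chartD(3)[OF chart[OF d(1)] d(2)] by simp
  have "frechet_derivative (f \<circ> inv_into V \<psi>) (at (\<psi> p)) u
      = frechet_derivative (f \<circ> inv_into U \<phi>) (at (\<phi> p)) (J u)" if f: "f \<in> smooth_functions A" for f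
  proof -
    let ?F = "frechet_derivative (f \<circ> inv_into U \<phi>) (at (\<phi> p))"
    have "((f \<circ> inv_into U \<phi>) has_derivative ?F) (at (?t (\<psi> p)))"
      unfolding tp using smooth_differentiable[OF f c] by (simp add: frechet_derivative_works[symmetric])
    from diff_chain_at[OF J this]
    have "(((f \<circ> inv_into U \<phi>) \<circ> ?t) has_derivative ?F \<circ> J) (at (\<psi> p))" .
    moreover have "((f \<circ> inv_into U \<phi>) \<circ> ?t) x = (f \<circ> inv_into V \<psi>) x" if "x \<in> \<psi> ` (V \<inter> U)" for x
      using that is_chartD(3)[OF chart[OF d(1)]] is_chartD(3)[OF chart[OF c(1)]] by auto
    ultimately have "((f \<circ> inv_into V \<psi>) has_derivative ?F \<circ> J) (at (\<psi> p))"
      using has_derivative_transform_within_open[OF _ o] c(2) d(2) by blast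
    from fun_cong[OF frechet_derivative_at[OF this, symmetric]] show ?thesis by simp
  qed
  then have "chart_vector (V, \<psi>) p u = chart_vector (U, \<phi>) p (J u)"
    by (auto simp: chart_vector_def)
  then show ?thesis ..
qed

lemma tangent_space_chart:
  assumes "(U, \<phi>) \<in> A" "p \<in> U"
  shows "tangent_space A p = range (chart_vector (U, \<phi>) p)"
proof (intro subset_antisym subsetI)
  fix v assume "v \<in> tangent_space A p"
  then show "v \<in> range (chart_vector (U, \<phi>) p)"
    using chart_vector_change[OF assms] unfolding tangent_space_chart_vector by force
next
  fix v assume "v \<in> range (chart_vector (U, \<phi>) p)"
  then show "v \<in> tangent_space A p"
    using assms by (force simp: tangent_space_chart_vector)
qed

lemma tangent_space_add:
  assumes "v \<in> tangent_space A p" "w \<in> tangent_space A p"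
  shows "v + w \<in> tangent_space A p"
proof -
  obtain U \<phi> where c: "(U, \<phi>) \<in> A" "p \<in> U" by (rule obtain_chart)
  obtain a b where "v = chart_vector (U, \<phi>) p a" "w = chart_vector (U, \<phi>) p b"
    using assms by (auto simp: tangent_space_chart[OF c])
  then have "v + w = chart_vector (U, \<phi>) p (a + b)"
    by (simp add: fun_eq_iff linear_add[OF linear_chart_vector[OF c]])
  then show ?thesis by (simp add: tangent_space_chart[OF c])
qed

lemma tangent_space_scale:
  assumes "v \<in> tangent_space A p"
  shows "(\<lambda>f. c * v f) \<in> tangent_space A p"
proof -
  obtain U \<phi> where c: "(U, \<phi>) \<in> A" "p \<in> U" by (rule obtain_chart)
  obtain a where "v = chart_vector (U, \<phi>) p a"
    using assms by (auto simp: tangent_space_chart[OF c])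
  then have "(\<lambda>f. c * v f) = chart_vector (U, \<phi>) p (c *\<^sub>R a)"
    by (simp add: fun_eq_iff linear_scale[OF linear_chart_vector[OF c]])
  then show ?thesis by (simp add: tangent_space_chart[OF c])
qed

lemma tangent_vector_nonsmooth:
  "v \<in> tangent_space A p \<Longrightarrow> f \<notin> smooth_functions A \<Longrightarrow> v f = 0"
  by (auto simp: tangent_space_def)

lemma tangent_vector_const: "v \<in> tangent_space A p \<Longrightarrow> v (\<lambda>_. c) = 0"
  by (auto simp: tangent_space_def comp_def)

lemma tangent_vector_add:
  assumes "v \<in> tangent_space A p" "f \<in> smooth_functions A" "h \<in> smooth_functions A"
  shows "v (f + h) = v f + v h"
proof -
  obtain U \<phi> u where c: "(U, \<phi>) \<in> A" "p \<in> U" and v: "v = chart_vector (U, \<phi>) p u"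
    using assms(1) by (auto simp: tangent_space_chart_vector)
  have "((f + h) \<circ> inv_into U \<phi> has_derivative
     (\<lambda>u. frechet_derivative (f \<circ> inv_into U \<phi>) (at (\<phi> p)) u
        + frechet_derivative (h \<circ> inv_into U \<phi>) (at (\<phi> p)) u)) (at (\<phi> p))"
    using has_derivative_add[OF smooth_differentiable[OF assms(2) c, unfolded frechet_derivative_works]
        smooth_differentiable[OF assms(3) c, unfolded frechet_derivative_works]]
    by (simp add: comp_def)
  from frechet_derivative_at[OF this, symmetric] show ?thesis
    using assms by (simp add: v chart_vector_def)
qed

lemma tangent_vector_scale:
  assumes "v \<in> tangent_space A p" "f \<in> smooth_functions A"
  shows "v (\<lambda>x. c * f x) = c * v f"
proof -
  obtain U \<phi> u where ch: "(U, \<phi>) \<in> A" "p \<in> U" and v: "v = chart_vector (U, \<phi>) p u"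
    using assms(1) by (auto simp: tangent_space_chart_vector)
  have s: "(\<lambda>x. c * f x) \<in> smooth_functions A"
    using smooth_mult[OF smooth_const[of c] assms(2)] by (simp add: times_fun_def)
  have "((\<lambda>x. c * f x) \<circ> inv_into U \<phi> has_derivative
     (\<lambda>u. c * frechet_derivative (f \<circ> inv_into U \<phi>) (at (\<phi> p)) u)) (at (\<phi> p))"
    using has_derivative_mult_right[OF smooth_differentiable[OF assms(2) ch, unfolded frechet_derivative_works]]
    by (simp add: comp_def)
  from frechet_derivative_at[OF this, symmetric] show ?thesis
    using assms s by (simp add: v chart_vector_def)
qed

section \<open>Vector fields as a module over the smooth functions\<close>

lemma vf_tangent: "X \<in> vector_fields A \<Longrightarrow> X p \<in> tangent_space A p"
  by (simp add: vector_fields_def)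

lemma smooth_dir [simp]:
  "X \<in> vector_fields A \<Longrightarrow> f \<in> smooth_functions A \<Longrightarrow> dir X f \<in> smooth_functions A"
  by (simp add: vector_fields_def dir_def)

lemma dir_const [simp]: "X \<in> vector_fields A \<Longrightarrow> dir X (\<lambda>_. c) = 0"
  by (simp add: dir_def fun_eq_iff tangent_vector_const[OF vf_tangent])

lemma vf_add [simp]:
  assumes "X \<in> vector_fields A" "Y \<in> vector_fields A"
  shows "X + Y \<in> vector_fields A"
proof -
  have "(\<lambda>p. X p f + Y p f) \<in> smooth_functions A" if "f \<in> smooth_functions A" for f
    using smooth_add[OF smooth_dir[OF assms(1) that] smooth_dir[OF assms(2) that]]
    by (simp add: dir_def plus_fun_def)
  then show ?thesis
    using assms by (simp add: vector_fields_def tangent_space_add)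
qed

lemma vf_fscale [simp]:
  assumes "h \<in> smooth_functions A" "X \<in> vector_fields A"
  shows "h \<odot> X \<in> vector_fields A"
proof -
  have "(\<lambda>p. h p * X p f) \<in> smooth_functions A" if "f \<in> smooth_functions A" for f
    using smooth_mult[OF assms(1) smooth_dir[OF assms(2) that]]
    by (simp add: dir_def times_fun_def)
  then show ?thesis
    using assms by (simp add: vector_fields_def tangent_space_scale fscale_def)
qed

lemma vf_cscale [simp]: "X \<in> vector_fields A \<Longrightarrow> c \<cdot> X \<in> vector_fields A"
  by (simp add: cscale_def)

lemma vf_uminus [simp]: "X \<in> vector_fields A \<Longrightarrow> - X \<in> vector_fields A"
  using vf_cscale[of X "- 1"] by (simp add: cscale_def fscale_def fun_Compl_def)

lemma vf_diff [simp]: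
  "X \<in> vector_fields A \<Longrightarrow> Y \<in> vector_fields A \<Longrightarrow> X - Y \<in> vector_fields A"
  using vf_add[of X "- Y"] by simp

lemma vf_zero [simp]: "0 \<in> vector_fields A"
proof -
  have "(0 :: 'a vfield) p \<in> tangent_space A p" for p
  proof -
    obtain U \<phi> where c: "(U, \<phi>) \<in> A" "p \<in> U" by (rule obtain_chart)
    have "(0 :: 'a vfield) p = chart_vector (U, \<phi>) p 0"
      by (simp add: fun_eq_iff linear_0[OF linear_chart_vector[OF c]])
    then show ?thesis by (simp add: tangent_space_chart[OF c])
  qed
  then show ?thesis
    by (simp add: vector_fields_def)
qed

lemma vf_sum:
  "(\<And>i. i \<in> I \<Longrightarrow> X i \<in> vector_fields A) \<Longrightarrow> (\<Sum>i\<in>I. X i) \<in> vector_fields A"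
  by (induction I rule: infinite_finite_induct) auto

end

section \<open>Frames of vector fields\<close>

lemma sum_fun_apply: "(\<Sum>i\<in>I. F i) x = (\<Sum>i\<in>I. F i x)"
  by (induction I rule: infinite_finite_induct) auto

lemma fscale_apply [simp]: "(h \<odot> X) p f = h p * X p f"
  by (simp add: fscale_def)

lemma cscale_apply [simp]: "(c \<cdot> X) p f = c * X p f"
  by (simp add: cscale_def)

lemma vfield_eqI:
  assumes "\<And>p f. X p f = Y p f"
  shows "X = Y"
  using assms by blast

text \<open>The Leibniz formula makes a determinant a polynomial in its entries. Used for the
  determinants of Cramer's rule.\<close>

lemma (in smooth_manifold) smooth_det:
  fixes M :: "'n::finite \<Rightarrow> 'n \<Rightarrow> 'a \<Rightarrow> real"
  assumes "\<And>i j. M i j \<in> smooth_functions A"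
  shows "(\<lambda>q. det (\<chi> i j. M i j q)) \<in> smooth_functions A"
proof -
  have prod: "(\<Prod>i\<in>J. N i) q = (\<Prod>i\<in>J. N i q)" for J and N :: "'n \<Rightarrow> 'a \<Rightarrow> real" and q
    by (induction J rule: infinite_finite_induct) auto
  have "(\<lambda>q. det (\<chi> i j. M i j q)) =
      (\<Sum>\<pi> | \<pi> permutes (UNIV :: 'n set). (\<lambda>_. of_int (sign \<pi>)) * (\<Prod>i\<in>UNIV. M i (\<pi> i)))"
    by (rule ext) (simp add: det_def sum_fun_apply prod)
  also have "\<dots> \<in> smooth_functions A"
    by (intro smooth_sum smooth_mult smooth_prod smooth_const assms)
  finally show ?thesis .
qed

text \<open>A dimension count: there are as many fields as chart coordinates. Independence at
  \<open>p\<close> makes the map \<open>L\<close> from coefficients to chart directions injective,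
  hence surjective, so the direction of \<open>v\<close> is some \<open>L x\<close>.\<close>

lemma spanning_frame:
  fixes A :: "('a::topological_space, real ^ 'n) chart set" and e :: "'n \<Rightarrow> 'a vfield"
  assumes A: "smooth_manifold A"
    and e: "\<And>i. e i \<in> vector_fields A"
    and indep: "\<And>c. (\<And>f. (\<Sum>i\<in>UNIV. c i * e i p f) = 0) \<Longrightarrow> c = (\<lambda>_. 0)"
    and v: "v \<in> tangent_space A p"
  shows "\<exists>c. \<forall>f. v f = (\<Sum>i\<in>UNIV. c i * e i p f)"
proof -
  interpret smooth_manifold A by fact
  obtain U \<phi> where c: "(U, \<phi>) \<in> A" "p \<in> U" by (rule obtain_chart)
  note lin = linear_chart_vector[OF c]
  have "\<forall>i. \<exists>u. e i p = chart_vector (U, \<phi>) p u"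
    using vf_tangent[OF e, of _ p] unfolding tangent_space_chart[OF c] by blast
  then obtain u where u: "\<And>i. e i p = chart_vector (U, \<phi>) p (u i)" by metis
  define L :: "real ^ 'n \<Rightarrow> real ^ 'n" where "L x = (\<Sum>i\<in>UNIV. x $ i *\<^sub>R u i)" for x
  have L: "chart_vector (U, \<phi>) p (L x) f = (\<Sum>i\<in>UNIV. x $ i * e i p f)" for x f
    by (simp add: L_def u linear_sum[OF lin] linear_scale[OF lin])
  have "linear L"
    by (rule linearI)
      (simp_all add: L_def scaleR_add_left sum.distrib scaleR_right.sum)
  moreover have "inj L"
    unfolding linear_injective_0[OF \<open>linear L\<close>]
  proof (intro allI impI)
    fix x assume "L x = 0"
    then have "(\<Sum>i\<in>UNIV. x $ i * e i p f) = 0" for f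
      using L[of x f] linear_0[OF lin] by simp
    then have "(\<lambda>i. x $ i) = (\<lambda>_. 0)" by (rule indep)
    then show "x = 0" by (simp add: vec_eq_iff fun_eq_iff)
  qed
  ultimately have "surj L" using linear_injective_imp_surjective[of L] by simp
  moreover obtain w where "v = chart_vector (U, \<phi>) p w"
    using v by (auto simp: tangent_space_chart[OF c])
  ultimately obtain x where "v = chart_vector (U, \<phi>) p (L x)" by (metis surj_def)
  then show ?thesis by (auto simp: L)
qed

text \<open>Global functions with nonsingular Jacobian at \<open>p\<close> come from linear independence alone,
  so no bump functions are needed.\<close>

lemma frame_coordinates:
  fixes A :: "('a::topological_space, real ^ 'n) chart set" and e :: "'n \<Rightarrow> 'a vfield"
  assumes A: "smooth_manifold A"
    and e: "\<And>i. e i \<in> vector_fields A"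
    and indep: "\<And>c. (\<And>f. (\<Sum>i\<in>UNIV. c i * e i p f) = 0) \<Longrightarrow> c = (\<lambda>_. 0)"
  shows "\<exists>F. (\<forall>j. F j \<in> smooth_functions A) \<and> det (\<chi> j i. e i p (F j)) \<noteq> (0 :: real)"
proof -
  interpret smooth_manifold A by fact
  define r :: "('a \<Rightarrow> real) \<Rightarrow> real ^ 'n" where "r f = (\<chi> i. e i p f)" for f
  define S where "S = r ` smooth_functions A"
  note tv = vf_tangent[OF e]
  have "subspace S"
    unfolding subspace_def
  proof (intro conjI ballI allI)
    have "r (\<lambda>_. 0) = 0"
      by (simp add: r_def vec_eq_iff tangent_vector_const[OF tv])
    then show "0 \<in> S" unfolding S_def by (metis image_eqI smooth_const)
  next
    fix x y assume "x \<in> S" "y \<in> S"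
    then obtain f h where "f \<in> smooth_functions A" "h \<in> smooth_functions A" "x = r f" "y = r h"
      by (auto simp: S_def)
    then have "x + y = r (f + h)" "f + h \<in> smooth_functions A"
      by (simp_all add: r_def vec_eq_iff tangent_vector_add[OF tv])
    then show "x + y \<in> S" by (auto simp: S_def)
  next
    fix c x assume "x \<in> S"
    then obtain f where f: "f \<in> smooth_functions A" "x = r f" by (auto simp: S_def)
    then have "c *\<^sub>R x = r (\<lambda>q. c * f q)"
      by (simp add: r_def vec_eq_iff tangent_vector_scale[OF tv])
    moreover have "(\<lambda>q. c * f q) \<in> smooth_functions A"
      using smooth_mult[OF smooth_const f(1)] by (simp add: times_fun_def)
    ultimately show "c *\<^sub>R x \<in> S" by (auto simp: S_def)
  qed
  \<comment> \<open>A nonzero vector orthogonal to a proper \<open>S\<close> would be a linear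
    relation among the \<open>e i p\<close> on all smooth functions. On the other functions the
    relation holds because tangent vectors vanish there.\<close>
  have "S = UNIV"
  proof (rule ccontr)
    assume "S \<noteq> UNIV"
    then obtain a where "a \<noteq> 0" and a: "\<And>x. x \<in> S \<Longrightarrow> a \<bullet> x = 0"
      using span_not_UNIV_orthogonal[of S] \<open>S \<noteq> UNIV\<close> \<open>subspace S\<close>
    by (metis span_eq_iff span_base)
    have "(\<Sum>i\<in>UNIV. a $ i * e i p f) = 0" for f
    proof (cases "f \<in> smooth_functions A")
      case True
      then show ?thesis using a[of "r f"] by (simp add: S_def r_def inner_vec_def)
    next
      case False
      then show ?thesis by (simp add: tangent_vector_nonsmooth[OF tv])
    qed
    then have "(\<lambda>i. a $ i) = (\<lambda>_. 0)" by (rule indep)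
    with \<open>a \<noteq> 0\<close> show False by (simp add: vec_eq_iff fun_eq_iff)
  qed
  then have "\<forall>j. \<exists>f\<in>smooth_functions A. r f = axis j 1"
    unfolding S_def by (metis UNIV_I imageE)
  then obtain F where F: "\<And>j. F j \<in> smooth_functions A" "\<And>j. r (F j) = axis j 1" by metis
  have "e i p (F j) = (if i = j then 1 else 0)" for i j
    using arg_cong[OF F(2)[of j], of "\<lambda>x. x $ i"] by (simp add: r_def axis_def)
  then have "(\<chi> j i. e i p (F j)) = mat 1"
    by (simp add: mat_def vec_eq_iff)
  then show ?thesis using F(1) by (intro exI[of _ F]) simp
qed

text \<open>Cramer's rule without division. At each point X is a combination of the frame with
  coefficients of unknown regularity; applying it to the functions \<open>F j\<close> gives a linear
  system for them with matrix \<open>M\<close>. The numerators \<open>a k\<close> and the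
  denominator \<open>d\<close> are determinants of smooth functions, so keeping \<open>d\<close> on
  the left yields an identity valid everywhere, also where \<open>d\<close> vanishes.\<close>

lemma frame_expansion:
  fixes A :: "('a::topological_space, real ^ 'n) chart set" and e :: "'n \<Rightarrow> 'a vfield"
  assumes A: "smooth_manifold A"
    and e: "\<And>i. e i \<in> vector_fields A"
    and indep: "\<And>c p. (\<And>f. (\<Sum>i\<in>UNIV. c i * e i p f) = 0) \<Longrightarrow> c = (\<lambda>_. 0)"
    and X: "X \<in> vector_fields A"
  shows "\<exists>d a. d \<in> smooth_functions A \<and> d p \<noteq> 0 \<and> (\<forall>i. a i \<in> smooth_functions A) \<and>
    d \<odot> X = (\<Sum>i\<in>UNIV. a i \<odot> e i)"
proof -
  interpret smooth_manifold A by fact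
  obtain F where F: "\<And>j. F j \<in> smooth_functions A" "det (\<chi> j i. e i p (F j)) \<noteq> (0 :: real)"
  proof -
    have "\<exists>F. (\<forall>j. F j \<in> smooth_functions A) \<and> det (\<chi> j i. e i p (F j)) \<noteq> (0 :: real)"
      by (rule frame_coordinates[OF A e]) (rule indep)
    then show ?thesis using that by blast
  qed
  define M where "M j i = dir (e i) (F j)" for j i
  define M' where "M' k j i = (if i = k then dir X (F j) else M j i)" for k j i
  define d where "d q = det (\<chi> j i. M j i q)" for q
  define a where "a k q = det (\<chi> j i. M' k j i q)" for k q
  have "d \<in> smooth_functions A" "\<And>k. a k \<in> smooth_functions A"
    unfolding d_def a_def using F(1) e X by (auto intro!: smooth_det simp: M_def M'_def)
  moreover have "d p \<noteq> 0" using F(2) by (simp add: d_def M_def dir_def)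
  moreover have "(d \<odot> X) q f = (\<Sum>i\<in>UNIV. a i \<odot> e i) q f" for q f
  proof -
    obtain c where c: "\<And>f. X q f = (\<Sum>i\<in>UNIV. c i * e i q f)"
    proof -
      have "\<exists>c. \<forall>f. X q f = (\<Sum>i\<in>UNIV. c i * e i q f)"
        by (rule spanning_frame[OF A e _ vf_tangent[OF X]]) (rule indep)
      then show ?thesis using that by blast
    qed
    \<comment> \<open>\<open>M'\<close> is \<open>M\<close> with column \<open>k\<close> replaced by
      the right-hand side of the system. \<open>cramer_lemma\<close> asks for no invertibility, so
      zeros of \<open>d\<close> are harmless.\<close>
    have "a k q = c k * d q" for k
    proof -
      have "((\<chi> j i. M j i q) *v (\<chi> i. c i)) $ j = X q (F j)" for j
        by (simp add: matrix_vector_mult_def M_def dir_def c mult.commute)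
      then show ?thesis
        using cramer_lemma[of k "\<chi> j i. M j i q" "\<chi> i. c i"]
        by (simp add: a_def d_def M'_def dir_def if_distrib[of "\<lambda>h. h q"] cong: if_cong)
    qed
    then show ?thesis
      by (simp add: c sum_fun_apply sum_distrib_left mult_ac)
  qed
  then have "d \<odot> X = (\<Sum>i\<in>UNIV. a i \<odot> e i)" by (rule vfield_eqI)
  ultimately show ?thesis by blast
qed

section \<open>Left-invariant fields on a Lie group\<close>

sublocale lie_group \<subseteq> smooth_manifold A
  by unfold_locales (rule atlas)

lemma (in lie_group) left_invariant_independent:
  assumes basis: "real_basis (lie_algebra A mul) I E"
    and zero: "\<And>f. (\<Sum>i\<in>I. c i * E i p f) = 0" and "i \<in> I"
  shows "c i = 0"
proof -
  have E: "E i \<in> vector_fields A"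
    "\<And>a p f. f \<in> smooth_functions A \<Longrightarrow> E i (mul a p) f = E i p (f \<circ> mul a)" if "i \<in> I" for i
    using basis that by (auto simp: real_basis_def lie_algebra_def)
  have "(\<Sum>i\<in>I. c i \<cdot> E i) q f = 0" for q f
  proof (cases "f \<in> smooth_functions A")
    case True
    \<comment> \<open>Left translation by \<open>b\<close> carries \<open>p\<close> to
      \<open>q\<close>. The assumption \<open>zero\<close> speaks about every function, so it
      applies to \<open>f \<circ> mul b\<close> as it stands.\<close>
    define b where "b = mul q (inv p)"
    have q: "q = mul b p" by (simp add: b_def assoc)
    have "(\<Sum>i\<in>I. c i * E i q f) = (\<Sum>i\<in>I. c i * E i p (f \<circ> mul b))"
      unfolding q by (intro sum.cong refl) (simp add: E(2)[OF _ True])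
    also have "\<dots> = 0" by (rule zero)
    finally show ?thesis by (simp add: sum_fun_apply)
  next
    case False
    then have "E i q f = 0" if "i \<in> I" for i
      using tangent_vector_nonsmooth[OF vf_tangent[OF E(1)[OF that]]] by blast
    then show ?thesis by (simp add: sum_fun_apply)
  qed
  then have "(\<Sum>i\<in>I. c i \<cdot> E i) = 0"
    by (intro vfield_eqI) (simp only: zero_fun_apply)
  then show ?thesis using basis \<open>i \<in> I\<close> by (simp add: real_basis_def)
qed

section \<open>Forms and endomorphism fields on sums with smooth coefficients\<close>

context smooth_manifold begin

lemma one_form_add:
  "one_form A \<omega> \<Longrightarrow> X \<in> vector_fields A \<Longrightarrow> Y \<in> vector_fields A \<Longrightarrow> \<omega> (X + Y) = \<omega> X + \<omega> Y"
  unfolding one_form_def by blast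

lemma one_form_zero: "one_form A \<omega> \<Longrightarrow> \<omega> 0 = 0"
  using one_form_add[OF _ vf_zero vf_zero] by (simp only: add_0_left add_cancel_right_right)

lemma one_form_fscale:
  "one_form A \<omega> \<Longrightarrow> h \<in> smooth_functions A \<Longrightarrow> X \<in> vector_fields A \<Longrightarrow> \<omega> (h \<odot> X) = h * \<omega> X"
  unfolding one_form_def by blast

lemma one_form_sum:
  assumes "one_form A \<omega>" "\<And>i. i \<in> I \<Longrightarrow> a i \<in> smooth_functions A" "\<And>i. i \<in> I \<Longrightarrow> X i \<in> vector_fields A"
  shows "\<omega> (\<Sum>i\<in>I. a i \<odot> X i) = (\<Sum>i\<in>I. a i * \<omega> (X i))"
  using assms(2,3)
proof (induction I rule: infinite_finite_induct)
  case (insert i I)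
  have "(\<Sum>i\<in>I. a i \<odot> X i) \<in> vector_fields A" "a i \<odot> X i \<in> vector_fields A"
    using insert.prems by (auto intro!: vf_sum vf_fscale)
  note step = sum.insert[OF insert.hyps] one_form_add[OF assms(1) this(2,1)]
    one_form_fscale[OF assms(1) insert.prems[OF insertI1]] insert.IH[OF insert.prems]
  show ?case by (simp only: step insertI2)
next
  case (infinite I)
  show ?case unfolding sum.infinite[OF infinite.hyps] by (rule one_form_zero[OF assms(1)])
next
  case empty
  show ?case unfolding sum.empty by (rule one_form_zero[OF assms(1)])
qed

lemma endo_field_add:
  "endo_field A S \<Longrightarrow> X \<in> vector_fields A \<Longrightarrow> Y \<in> vector_fields A \<Longrightarrow> S (X + Y) = S X + S Y"
  unfolding endo_field_def by blast

lemma endo_field_zero: "endo_field A S \<Longrightarrow> S 0 = 0"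
  using endo_field_add[OF _ vf_zero vf_zero] by (simp only: add_0_left add_cancel_right_right)

lemma endo_field_fscale:
  "endo_field A S \<Longrightarrow> h \<in> smooth_functions A \<Longrightarrow> X \<in> vector_fields A \<Longrightarrow> S (h \<odot> X) = h \<odot> S X"
  unfolding endo_field_def by blast

lemma endo_field_sum:
  assumes "endo_field A S" "\<And>i. i \<in> I \<Longrightarrow> a i \<in> smooth_functions A" "\<And>i. i \<in> I \<Longrightarrow> X i \<in> vector_fields A"
  shows "S (\<Sum>i\<in>I. a i \<odot> X i) = (\<Sum>i\<in>I. a i \<odot> S (X i))"
  using assms(2,3)
proof (induction I rule: infinite_finite_induct)
  case (insert i I)
  have "(\<Sum>i\<in>I. a i \<odot> X i) \<in> vector_fields A" "a i \<odot> X i \<in> vector_fields A"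
    using insert.prems by (auto intro!: vf_sum vf_fscale)
  note step = sum.insert[OF insert.hyps] endo_field_add[OF assms(1) this(2,1)]
    endo_field_fscale[OF assms(1) insert.prems[OF insertI1]] insert.IH[OF insert.prems]
  show ?case by (simp only: step insertI2)
next
  case (infinite I)
  show ?case unfolding sum.infinite[OF infinite.hyps] by (rule endo_field_zero[OF assms(1)])
next
  case empty
  show ?case unfolding sum.empty by (rule endo_field_zero[OF assms(1)])
qed

end

locale metric_manifold = smooth_manifold A
  for A :: "('a::topological_space, 'e::euclidean_space) chart set" +
  fixes g :: "'a vfield \<Rightarrow> 'a vfield \<Rightarrow> 'a \<Rightarrow> real"
  assumes metric: "pseudo_riemannian A g"

text \<open>The numbers \<open>\<epsilon> i\<close> carry the signature. The axiom
  \<open>frame\<close> is a global expansion with smooth coefficients, the form in which tensor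
  fields can be evaluated on it term by term.\<close>

locale orthogonal_frame = metric_manifold A g
  for A :: "('a::topological_space, 'e::euclidean_space) chart set" and g +
  fixes I :: "'i set" and E :: "'i \<Rightarrow> 'a vfield" and \<epsilon> :: "'i \<Rightarrow> real"
  assumes finite_index: "finite I"
    and frame_vf [simp]: "i \<in> I \<Longrightarrow> E i \<in> vector_fields A"
    and frame_metric: "i \<in> I \<Longrightarrow> j \<in> I \<Longrightarrow> g (E i) (E j) = (\<lambda>_. if i = j then \<epsilon> i else 0)"
    and \<epsilon>_nonzero: "i \<in> I \<Longrightarrow> \<epsilon> i \<noteq> 0"
    and frame: "X \<in> vector_fields A \<Longrightarrow> X = (\<Sum>i\<in>I. (\<lambda>p. g X (E i) p / \<epsilon> i) \<odot> E i)"

text \<open>The remainder \<open>X - R\<close> after projection to the frame is orthogonal to every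
  \<open>E j\<close>. By \<open>frame_expansion\<close> a multiple \<open>d \<odot> (X - R)\<close>
  is a combination of the frame with smooth coefficients, and pairing with the frame shows that all
  of these vanish. Since \<open>d\<close> is nonzero at the chosen point, so is every obstruction to
  cancelling it there, and the remainder is zero.\<close>

lemma left_invariant_orthogonal_frame:
  fixes A :: "('a::{t2_space, second_countable_topology}, real ^ 'n) chart set"
    and mul :: "'a \<Rightarrow> 'a \<Rightarrow> 'a" and one :: 'a and inv :: "'a \<Rightarrow> 'a"
  assumes G: "lie_group mul one inv A" and basis: "real_basis (lie_algebra A mul) I E"
    and I: "card I = CARD('n)" and g: "pseudo_riemannian A g"
    and gE: "\<And>i j. i \<in> I \<Longrightarrow> j \<in> I \<Longrightarrow> g (E i) (E j) = (\<lambda>_. if i = j then \<epsilon> i else 0)"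
    and \<epsilon>: "\<And>i. i \<in> I \<Longrightarrow> \<epsilon> i \<noteq> 0"
  shows "orthogonal_frame A g I E \<epsilon>"
proof -
  interpret lie_group mul one inv A by fact
  have fin: "finite I" using I by (intro card_ge_0_finite) simp
  have E: "E i \<in> vector_fields A" if "i \<in> I" for i
    using basis that by (auto simp: real_basis_def lie_algebra_def)
  \<comment> \<open>The expansion lemma indexes the frame by the coordinate type \<open>'n\<close>,
    the basis is indexed by \<open>I\<close>; \<open>h\<close> translates.\<close>
  obtain h where h: "bij_betw h (UNIV :: 'n set) I"
    using finite_same_card_bij[of "UNIV :: 'n set" I] I fin by auto
  then have hI: "h k \<in> I" for k by (auto simp: bij_betw_def)
  have indep: "c = (\<lambda>_. 0)" if "\<And>f. (\<Sum>k\<in>UNIV. c k * E (h k) p f) = 0" for c p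
  proof -
    define b where "b = c \<circ> the_inv_into UNIV h"
    have b: "b (h k) = c k" for k
      using h by (simp add: b_def bij_betw_def the_inv_into_f_f)
    have "(\<Sum>i\<in>I. b i * E i p f) = 0" for f
      using that[of f] sum.reindex_bij_betw[OF h, of "\<lambda>i. b i * E i p f"] by (simp add: b)
    then have "b (h k) = 0" for k using left_invariant_independent[OF basis _ hI] by blast
    then show ?thesis by (simp add: b fun_eq_iff)
  qed
  have form: "one_form A (g X)" if "X \<in> vector_fields A" for X
    using g that by (simp add: pseudo_riemannian_def)
  have metric_sym: "g X Y = g Y X" if "X \<in> vector_fields A" "Y \<in> vector_fields A" for X Y
    using g that by (simp add: pseudo_riemannian_def)
  have smooth: "g X Y \<in> smooth_functions A" if "X \<in> vector_fields A" "Y \<in> vector_fields A" for X Y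
    using form that by (simp add: one_form_def)
  show ?thesis
  proof unfold_locales
    fix X assume X: "X \<in> vector_fields A"
    define b where "b i = (\<lambda>p. g X (E i) p / \<epsilon> i)" for i
    have b: "b i \<in> smooth_functions A" if "i \<in> I" for i
      using smooth_mult[OF smooth[OF X E[OF that]] smooth_const[of "1 / \<epsilon> i"]]
      by (simp add: b_def times_fun_def)
    define R where "R = (\<Sum>i\<in>I. b i \<odot> E i)"
    have R: "R \<in> vector_fields A" unfolding R_def using b E by (intro vf_sum vf_fscale)
    have lin: "g (E j) (\<Sum>i\<in>I. a i \<odot> E i) = (\<lambda>p. a j p * \<epsilon> j)"
      if "j \<in> I" "\<And>i. i \<in> I \<Longrightarrow> a i \<in> smooth_functions A" for a j
    proof -
      have "g (E j) (\<Sum>i\<in>I. a i \<odot> E i) = (\<Sum>i\<in>I. a i * g (E j) (E i))"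
        by (rule one_form_sum[OF form[OF E[OF that(1)]] that(2) E])
      moreover have "(\<Sum>i\<in>I. a i * g (E j) (E i)) p = (\<Sum>i\<in>I. if i = j then a j p * \<epsilon> j else 0)" for p
        unfolding sum_fun_apply using that(1) by (intro sum.cong) (auto simp: gE)
      ultimately show ?thesis using fin that(1) by (simp add: fun_eq_iff)
    qed
    have add: "g (E j) X = g (E j) (X - R) + g (E j) R" if "j \<in> I" for j
      using form[OF E[OF that]] vf_diff[OF X R] R unfolding one_form_def
      by (metis diff_add_cancel)
    have ort: "g (E j) (X - R) = 0" if "j \<in> I" for j
      using add[OF that] lin[of j b] b that \<epsilon>[OF that] metric_sym[OF X E[OF that]]
      by (simp add: R_def b_def fun_eq_iff)
    have "(X - R) p = 0" for p
    proof -
      obtain d a where d: "d \<in> smooth_functions A" "d p \<noteq> 0"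
        and a: "\<And>k. a k \<in> smooth_functions A" and exp: "d \<odot> (X - R) = (\<Sum>k\<in>UNIV. a k \<odot> E (h k))"
      proof -
        have "\<exists>d a. d \<in> smooth_functions A \<and> d p \<noteq> 0 \<and> (\<forall>k. a k \<in> smooth_functions A) \<and>
            d \<odot> (X - R) = (\<Sum>k\<in>UNIV. a k \<odot> E (h k))"
          by (rule frame_expansion[OF smooth_manifold_axioms E[OF hI] _ vf_diff[OF X R]]) (rule indep)
        then show ?thesis using that by blast
      qed
      have "a k = 0" for k
      proof -
        define a' where "a' = a \<circ> the_inv_into UNIV h"
        have a': "a' (h k) = a k" for k
          using h by (simp add: a'_def bij_betw_def the_inv_into_f_f)
        have "(\<Sum>k\<in>UNIV. a k \<odot> E (h k)) = (\<Sum>i\<in>I. a' i \<odot> E i)"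
          using sum.reindex_bij_betw[OF h, of "\<lambda>i. a' i \<odot> E i"] by (simp add: a')
        moreover have "g (E (h k)) (d \<odot> (X - R)) = 0"
          using form[OF E[OF hI]] vf_diff[OF X R] d(1) ort[OF hI[of k]] by (simp add: one_form_def)
        moreover have "a' i \<in> smooth_functions A" for i by (simp add: a'_def a)
        ultimately have "(\<lambda>p. a k p * \<epsilon> (h k)) = 0"
          using lin[of "h k" a', OF hI] by (simp only: exp a')
        then have "a k q * \<epsilon> (h k) = 0" for q by (metis zero_fun_apply)
        then show ?thesis using \<epsilon>[OF hI] by (simp add: fun_eq_iff)
      qed
      then have "(d \<odot> (X - R)) p f = 0" for f
        by (simp add: exp sum_fun_apply del: fscale_apply) (simp add: zero_fun_def)
      then show ?thesis using d(2) by (simp add: fun_eq_iff)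
    qed
    then have "X = R" by (simp add: fun_eq_iff)
    then show "X = (\<Sum>i\<in>I. (\<lambda>p. g X (E i) p / \<epsilon> i) \<odot> E i)"
      by (simp add: R_def b_def)
  qed (use g fin E gE \<epsilon> in auto)
qed

section \<open>Calculus of connections and endomorphism fields\<close>

context smooth_manifold begin

lemma endo_field_vf: "endo_field A S \<Longrightarrow> X \<in> vector_fields A \<Longrightarrow> S X \<in> vector_fields A"
  unfolding endo_field_def by blast

lemma endo_field_cscale:
  "endo_field A S \<Longrightarrow> X \<in> vector_fields A \<Longrightarrow> S (c \<cdot> X) = c \<cdot> S X"
  unfolding cscale_def by (rule endo_field_fscale) simp_all

lemma uminus_cscale: "- X = (- 1) \<cdot> X"
  by (rule vfield_eqI) simp

lemma endo_field_uminus: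
  "endo_field A S \<Longrightarrow> X \<in> vector_fields A \<Longrightarrow> S (- X) = - S X"
  unfolding uminus_cscale by (rule endo_field_cscale)

lemma endo_field_diff:
  assumes "endo_field A S" "X \<in> vector_fields A" "Y \<in> vector_fields A"
  shows "S (X - Y) = S X - S Y"
  using endo_field_add[OF assms(1,2) vf_uminus[OF assms(3)]] endo_field_uminus[OF assms(1,3)]
  by simp

lemma endo_fieldI:
  assumes "\<And>X. X \<in> vector_fields A \<Longrightarrow> S X \<in> vector_fields A"
    "\<And>X Y p f. X \<in> vector_fields A \<Longrightarrow> Y \<in> vector_fields A \<Longrightarrow> S (X + Y) p f = S X p f + S Y p f"
    "\<And>h X p f. h \<in> smooth_functions A \<Longrightarrow> X \<in> vector_fields A \<Longrightarrow> S (h \<odot> X) p f = h p * S X p f"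
  shows "endo_field A S"
  using assms by (auto simp: endo_field_def intro!: vfield_eqI)

lemma one_formI:
  assumes "\<And>X. X \<in> vector_fields A \<Longrightarrow> \<omega> X \<in> smooth_functions A"
    "\<And>X Y p. X \<in> vector_fields A \<Longrightarrow> Y \<in> vector_fields A \<Longrightarrow> \<omega> (X + Y) p = \<omega> X p + \<omega> Y p"
    "\<And>h X p. h \<in> smooth_functions A \<Longrightarrow> X \<in> vector_fields A \<Longrightarrow> \<omega> (h \<odot> X) p = h p * \<omega> X p"
  shows "one_form A \<omega>"
  unfolding one_form_def by (intro conjI ballI ext) (use assms in auto)

lemma connection_endo:
  "linear_connection A D \<Longrightarrow> Y \<in> vector_fields A \<Longrightarrow> endo_field A (\<lambda>X. D X Y)"
  unfolding linear_connection_def by blast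

lemma connection_vf:
  "linear_connection A D \<Longrightarrow> X \<in> vector_fields A \<Longrightarrow> Y \<in> vector_fields A \<Longrightarrow> D X Y \<in> vector_fields A"
  using connection_endo endo_field_vf by blast

lemma connection_add:
  "linear_connection A D \<Longrightarrow> X \<in> vector_fields A \<Longrightarrow> Y \<in> vector_fields A \<Longrightarrow> Z \<in> vector_fields A \<Longrightarrow>
    D X (Y + Z) = D X Y + D X Z"
  unfolding linear_connection_def by blast

lemma connection_fscale:
  "linear_connection A D \<Longrightarrow> X \<in> vector_fields A \<Longrightarrow> Y \<in> vector_fields A \<Longrightarrow> h \<in> smooth_functions A \<Longrightarrow>
    D X (h \<odot> Y) = dir X h \<odot> Y + h \<odot> D X Y"
  unfolding linear_connection_def by blast

lemma connection_cscale:
  assumes "linear_connection A D" "X \<in> vector_fields A" "Y \<in> vector_fields A"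
  shows "D X (c \<cdot> Y) = c \<cdot> D X Y"
proof -
  have "D X (c \<cdot> Y) = dir X (\<lambda>_. c) \<odot> Y + (\<lambda>_. c) \<odot> D X Y"
    unfolding cscale_def by (rule connection_fscale[OF assms]) simp
  then show ?thesis unfolding dir_const[OF assms(2)] by (auto intro!: vfield_eqI)
qed

lemma connection_diff:
  assumes "linear_connection A D" "X \<in> vector_fields A" "Y \<in> vector_fields A" "Z \<in> vector_fields A"
  shows "D X (Y - Z) = D X Y - D X Z"
  using connection_add[OF assms(1-3) vf_cscale[OF assms(4), of "- 1"]]
    connection_cscale[OF assms(1,2,4), of "- 1"]
  unfolding uminus_cscale[symmetric] by simp

lemma connection_zero:
  assumes "linear_connection A D" "X \<in> vector_fields A"
  shows "D X 0 = 0"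
  using connection_diff[OF assms vf_zero vf_zero] by simp

lemma connection_sum_cscale:
  assumes "linear_connection A D" "X \<in> vector_fields A" "\<And>i. i \<in> I \<Longrightarrow> Y i \<in> vector_fields A"
  shows "D X (\<Sum>i\<in>I. c i \<cdot> Y i) = (\<Sum>i\<in>I. c i \<cdot> D X (Y i))"
  using assms(3)
proof (induction I rule: infinite_finite_induct)
  case (insert i I)
  have vf: "c i \<cdot> Y i \<in> vector_fields A" "(\<Sum>i\<in>I. c i \<cdot> Y i) \<in> vector_fields A"
    using insert.prems by (auto intro!: vf_sum vf_cscale)
  show ?case
    unfolding sum.insert[OF insert.hyps] connection_add[OF assms(1,2) vf]
    using insert by (simp only: connection_cscale[OF assms(1,2)] insertI1 insertI2)
next
  case (infinite I)
  show ?case unfolding sum.infinite[OF infinite.hyps] by (rule connection_zero[OF assms(1,2)])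
next
  case empty
  show ?case unfolding sum.empty by (rule connection_zero[OF assms(1,2)])
qed

lemma endo_field_sum_cscale:
  assumes "endo_field A S" "\<And>i. i \<in> I \<Longrightarrow> X i \<in> vector_fields A"
  shows "S (\<Sum>i\<in>I. c i \<cdot> X i) = (\<Sum>i\<in>I. c i \<cdot> S (X i))"
  unfolding cscale_def by (rule endo_field_sum[OF assms(1)]) (simp_all add: assms(2))

lemma endo_field_compose:
  assumes "endo_field A S" "endo_field A R"
  shows "endo_field A (\<lambda>X. S (R X))"
  using endo_field_vf[OF assms(1)] endo_field_vf[OF assms(2)]
  by (intro endo_fieldI)
    (simp_all only: endo_field_add[OF assms(1)] endo_field_add[OF assms(2)]
      endo_field_fscale[OF assms(1)] endo_field_fscale[OF assms(2)] plus_fun_apply fscale_apply)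

lemma endo_field_minus:
  assumes "endo_field A S" "endo_field A R"
  shows "endo_field A (\<lambda>X. S X - R X)"
  using assms
  by (intro endo_fieldI) (simp_all add: endo_field_vf endo_field_add endo_field_fscale right_diff_distrib)

text \<open>In the second slot both terms of \<open>cov_endo\<close> produce
  \<open>dir X h \<odot> S Y\<close>, because S is linear over functions; these derivative terms
  cancel.\<close>

lemma cov_endo_tensor:
  assumes D: "linear_connection A D" and S: "endo_field A S"
  shows "Y \<in> vector_fields A \<Longrightarrow> endo_field A (\<lambda>X. cov_endo D S X Y)"
    and "X \<in> vector_fields A \<Longrightarrow> endo_field A (cov_endo D S X)"
proof -
  show "endo_field A (\<lambda>X. cov_endo D S X Y)" if "Y \<in> vector_fields A"
    unfolding cov_endo_def
    by (intro endo_field_minus connection_endo[OF D] endo_field_compose[OF S] endo_field_vf[OF S] that)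
  show "endo_field A (cov_endo D S X)" if X: "X \<in> vector_fields A"
  proof (rule endo_fieldI)
    show "cov_endo D S X Y \<in> vector_fields A" if "Y \<in> vector_fields A" for Y
      unfolding cov_endo_def by (simp add: endo_field_vf[OF S] connection_vf[OF D] X that)
    show "cov_endo D S X (Y + Z) p f = cov_endo D S X Y p f + cov_endo D S X Z p f"
      if "Y \<in> vector_fields A" "Z \<in> vector_fields A" for Y Z p f
      by (simp add: cov_endo_def endo_field_add[OF S] connection_add[OF D]
          endo_field_vf[OF S] connection_vf[OF D] X that)
    show "cov_endo D S X (h \<odot> Y) p f = h p * cov_endo D S X Y p f"
      if "h \<in> smooth_functions A" "Y \<in> vector_fields A" for h Y p f
      by (simp add: cov_endo_def endo_field_add[OF S] endo_field_fscale[OF S] connection_fscale[OF D]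
          endo_field_vf[OF S] connection_vf[OF D] X that right_diff_distrib)
  qed
qed

text \<open>The derivative term of the Leibniz rule comes from N alone, B being linear over
  functions in both slots. Used for D with \<open>c = 1/2\<close>.\<close>

lemma linear_connection_plus_tensor:
  assumes N: "linear_connection A N"
    and B1: "\<And>Y. Y \<in> vector_fields A \<Longrightarrow> endo_field A (\<lambda>X. B X Y)"
    and B2: "\<And>X. X \<in> vector_fields A \<Longrightarrow> endo_field A (B X)"
    and D: "\<And>X Y. X \<in> vector_fields A \<Longrightarrow> Y \<in> vector_fields A \<Longrightarrow> D X Y = N X Y + c \<cdot> B X Y"
  shows "linear_connection A D"
  unfolding linear_connection_def
proof (intro conjI ballI)
  note vf = connection_vf[OF N] endo_field_vf[OF B2]
  note N1 = connection_endo[OF N]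
  show "endo_field A (\<lambda>X. D X Y)" if "Y \<in> vector_fields A" for Y
    by (rule endo_fieldI)
      (simp_all add: D that vf endo_field_add[OF N1] endo_field_add[OF B1]
        endo_field_fscale[OF N1] endo_field_fscale[OF B1] algebra_simps)
  show "D X (Y + Z) = D X Y + D X Z"
    if "X \<in> vector_fields A" "Y \<in> vector_fields A" "Z \<in> vector_fields A" for X Y Z
    by (rule vfield_eqI) (simp add: D that connection_add[OF N] endo_field_add[OF B2] algebra_simps)
  show "D X (h \<odot> Y) = dir X h \<odot> Y + h \<odot> D X Y"
    if "X \<in> vector_fields A" "Y \<in> vector_fields A" "h \<in> smooth_functions A" for X Y h
    by (rule vfield_eqI) (simp add: D that connection_fscale[OF N] endo_field_fscale[OF B2] algebra_simps)
qed

end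

section \<open>Metric connections\<close>

context metric_manifold begin

lemma form: "X \<in> vector_fields A \<Longrightarrow> one_form A (g X)"
  using metric by (simp add: pseudo_riemannian_def)

lemma metric_sym: "X \<in> vector_fields A \<Longrightarrow> Y \<in> vector_fields A \<Longrightarrow> g X Y = g Y X"
  using metric by (simp add: pseudo_riemannian_def)

lemma smooth_metric [simp]:
  "X \<in> vector_fields A \<Longrightarrow> Y \<in> vector_fields A \<Longrightarrow> g X Y \<in> smooth_functions A"
  using form by (simp add: one_form_def)

lemma nondegenerate:
  assumes "X \<in> vector_fields A" "\<And>Y p. Y \<in> vector_fields A \<Longrightarrow> g X Y p = 0"
  shows "X = 0"
proof (rule vfield_eqI)
  fix p f
  have "X p = 0" using metric assms unfolding pseudo_riemannian_def by blast
  then show "X p f = 0 p f" by simp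
qed

lemma metric_add_right:
  "X \<in> vector_fields A \<Longrightarrow> Y \<in> vector_fields A \<Longrightarrow> Z \<in> vector_fields A \<Longrightarrow>
    g X (Y + Z) p = g X Y p + g X Z p"
  by (simp add: one_form_add[OF form])

lemma metric_fscale_right:
  "X \<in> vector_fields A \<Longrightarrow> Y \<in> vector_fields A \<Longrightarrow> h \<in> smooth_functions A \<Longrightarrow>
    g X (h \<odot> Y) p = h p * g X Y p"
  by (simp add: one_form_fscale[OF form])

lemma metric_cscale_right:
  "X \<in> vector_fields A \<Longrightarrow> Y \<in> vector_fields A \<Longrightarrow> g X (c \<cdot> Y) p = c * g X Y p"
  unfolding cscale_def by (rule metric_fscale_right) simp_all

lemma metric_uminus_right:
  "X \<in> vector_fields A \<Longrightarrow> Y \<in> vector_fields A \<Longrightarrow> g X (- Y) p = - g X Y p"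
  unfolding uminus_cscale by (simp add: metric_cscale_right)

lemma metric_diff_right:
  "X \<in> vector_fields A \<Longrightarrow> Y \<in> vector_fields A \<Longrightarrow> Z \<in> vector_fields A \<Longrightarrow>
    g X (Y - Z) p = g X Y p - g X Z p"
  using metric_add_right[of X Y "- Z" p] by (simp add: metric_uminus_right)

lemma metric_zero_right: "X \<in> vector_fields A \<Longrightarrow> g X 0 p = 0"
  by (simp add: one_form_zero[OF form])

lemmas metric_right = metric_add_right metric_diff_right metric_uminus_right metric_fscale_right
  metric_cscale_right metric_zero_right

lemma metric_left:
  assumes "Z \<in> vector_fields A"
  shows "X \<in> vector_fields A \<Longrightarrow> Y \<in> vector_fields A \<Longrightarrow> g (X + Y) Z p = g X Z p + g Y Z p"
    and "X \<in> vector_fields A \<Longrightarrow> Y \<in> vector_fields A \<Longrightarrow> g (X - Y) Z p = g X Z p - g Y Z p"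
    and "X \<in> vector_fields A \<Longrightarrow> g (- X) Z p = - g X Z p"
    and "X \<in> vector_fields A \<Longrightarrow> h \<in> smooth_functions A \<Longrightarrow> g (h \<odot> X) Z p = h p * g X Z p"
    and "X \<in> vector_fields A \<Longrightarrow> g (c \<cdot> X) Z p = c * g X Z p"
    and "g 0 Z p = 0"
  using assms by (simp_all add: metric_sym[of _ Z] metric_right)

lemma sum_vf: "(\<And>i. i \<in> I \<Longrightarrow> X i \<in> vector_fields A) \<Longrightarrow> (\<Sum>i\<in>I. c i \<cdot> X i) \<in> vector_fields A"
  by (intro vf_sum vf_cscale)

lemma metric_sum_left:
  assumes "Z \<in> vector_fields A" "\<And>i. i \<in> I \<Longrightarrow> X i \<in> vector_fields A"
  shows "g (\<Sum>i\<in>I. c i \<cdot> X i) Z p = (\<Sum>i\<in>I. c i * g (X i) Z p)"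
proof -
  have "g Z (\<Sum>i\<in>I. c i \<cdot> X i) = (\<Sum>i\<in>I. (\<lambda>_. c i) * g Z (X i))"
    unfolding cscale_def by (rule one_form_sum[OF form[OF assms(1)]]) (simp_all add: assms(2))
  then have "g Z (\<Sum>i\<in>I. c i \<cdot> X i) p = (\<Sum>i\<in>I. c i * g Z (X i) p)"
    by (simp only: sum_fun_apply times_fun_apply)
  moreover have "g Z (X i) p = g (X i) Z p" if "i \<in> I" for i
    using metric_sym[OF assms(1) assms(2)[OF that]] by simp
  moreover have "g (\<Sum>i\<in>I. c i \<cdot> X i) Z = g Z (\<Sum>i\<in>I. c i \<cdot> X i)"
    by (rule metric_sym[OF sum_vf[OF assms(2)] assms(1)])
  ultimately show ?thesis by simp
qed

end

section \<open>The Levi-Civita connection\<close>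

locale levi_civita_manifold = metric_manifold A g
  for A :: "('a::topological_space, 'e::euclidean_space) chart set" and g +
  fixes N :: "'a vfield \<Rightarrow> 'a vfield \<Rightarrow> 'a vfield"
  assumes LC: "levi_civita A g N"
begin

lemma connection: "linear_connection A N"
  using LC by (simp add: levi_civita_def)

lemmas nabla_vf [simp] = connection_vf[OF connection]

lemma bracket_eq:
  assumes "X \<in> vector_fields A" "Y \<in> vector_fields A"
  shows "bracket X Y = N X Y - N Y X"
proof -
  have "N X Y - N Y X - bracket X Y = 0"
    using LC assms by (simp only: levi_civita_def torsion_def)
  then show ?thesis by (simp only: eq_iff_diff_eq_0[symmetric]) 
qed

lemma metric_compatible:
  assumes "X \<in> vector_fields A" "Y \<in> vector_fields A" "Z \<in> vector_fields A"
  shows "dir X (g Y Z) p = g (N X Y) Z p + g Y (N X Z) p"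
proof -
  have "cov_metric N g X Y Z p = 0"
    using LC assms by (simp add: levi_civita_def)
  then show ?thesis by (simp add: cov_metric_def)
qed

end

section \<open>Tensor identities as matrix identities in a frame\<close>

context orthogonal_frame begin

lemma smooth_coefficient:
  assumes "X \<in> vector_fields A" "i \<in> I"
  shows "(\<lambda>p. g X (E i) p / \<epsilon> i) \<in> smooth_functions A"
  using smooth_mult[OF smooth_metric[OF assms(1) frame_vf[OF assms(2)]] smooth_const[of "1 / \<epsilon> i"]]
  by (simp add: times_fun_def)

lemma endo_field_eqI:
  assumes S: "endo_field A S" and R: "endo_field A R" and eq: "\<And>i. i \<in> I \<Longrightarrow> S (E i) = R (E i)"
    and X: "X \<in> vector_fields A"
  shows "S X = R X"
proof -
  note sm = smooth_coefficient[OF X]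
  show ?thesis
    by (subst (1 2) frame[OF X])
      (simp only: endo_field_sum[OF S sm frame_vf] endo_field_sum[OF R sm frame_vf] eq cong: sum.cong)
qed

lemma one_form_eqI:
  assumes S: "one_form A S" and R: "one_form A R" and eq: "\<And>i. i \<in> I \<Longrightarrow> S (E i) = R (E i)"
    and X: "X \<in> vector_fields A"
  shows "S X = R X"
proof -
  note sm = smooth_coefficient[OF X]
  show ?thesis
    by (subst (1 2) frame[OF X])
      (simp only: one_form_sum[OF S sm frame_vf] one_form_sum[OF R sm frame_vf] eq cong: sum.cong)
qed

lemma frame_const_coefficients:
  assumes "X \<in> vector_fields A" "\<And>i. i \<in> I \<Longrightarrow> g X (E i) = (\<lambda>_. c i * \<epsilon> i)"
  shows "X = (\<Sum>i\<in>I. c i \<cdot> E i)"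
  unfolding cscale_def
  by (subst frame[OF assms(1)], intro sum.cong refl) (simp add: assms(2) \<epsilon>_nonzero)

lemma metric_sum_frame:
  assumes "j \<in> I"
  shows "g (\<Sum>i\<in>I. c i \<cdot> E i) (E j) p = c j * \<epsilon> j"
proof -
  have "g (\<Sum>i\<in>I. c i \<cdot> E i) (E j) p = (\<Sum>i\<in>I. c i * g (E i) (E j) p)"
    using assms by (intro metric_sum_left) simp_all
  also have "\<dots> = (\<Sum>i\<in>I. if i = j then c j * \<epsilon> j else 0)"
    using assms by (intro sum.cong refl) (simp add: frame_metric)
  finally show ?thesis using assms finite_index by simp
qed

text \<open>Coordinates are row vectors, multiplied by the matrix \<open>s\<close> from the right;
  this fixes the order of the factors in the commutation conditions below.\<close>

lemma endo_field_frame_sum: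
  assumes S: "endo_field A S" and s: "\<And>k. k \<in> I \<Longrightarrow> S (E k) = (\<Sum>l\<in>I. s k l \<cdot> E l)"
  shows "S (\<Sum>k\<in>I. c k \<cdot> E k) = (\<Sum>l\<in>I. (\<Sum>k\<in>I. c k * s k l) \<cdot> E l)"
proof -
  have "S (\<Sum>k\<in>I. c k \<cdot> E k) = (\<Sum>k\<in>I. c k \<cdot> S (E k))"
    by (rule endo_field_sum_cscale[OF S frame_vf])
  also have "\<dots> = (\<Sum>k\<in>I. c k \<cdot> (\<Sum>l\<in>I. s k l \<cdot> E l))"
    by (intro sum.cong refl) (simp only: s)
  finally show ?thesis
    by (auto intro!: vfield_eqI simp: sum_fun_apply sum_distrib_left sum_distrib_right mult.assoc
        intro: sum.swap)
qed

text \<open>Constant coefficients have derivative zero, so along \<open>E i\<close> the connection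
  acts on them like an endomorphism, through a matrix.\<close>

lemma connection_frame_sum:
  assumes D: "linear_connection A D" and i: "i \<in> I"
    and d: "\<And>k. k \<in> I \<Longrightarrow> D (E i) (E k) = (\<Sum>l\<in>I. d k l \<cdot> E l)"
  shows "D (E i) (\<Sum>k\<in>I. c k \<cdot> E k) = (\<Sum>l\<in>I. (\<Sum>k\<in>I. c k * d k l) \<cdot> E l)"
proof -
  have "D (E i) (\<Sum>k\<in>I. c k \<cdot> E k) = (\<Sum>k\<in>I. c k \<cdot> D (E i) (E k))"
    by (rule connection_sum_cscale[OF D frame_vf[OF i] frame_vf])
  also have "\<dots> = (\<Sum>k\<in>I. c k \<cdot> (\<Sum>l\<in>I. d k l \<cdot> E l))"
    by (intro sum.cong refl) (simp only: d)
  finally show ?thesis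
    by (auto intro!: vfield_eqI simp: sum_fun_apply sum_distrib_left sum_distrib_right mult.assoc
        intro: sum.swap)
qed

lemma endo_field_commute_frame:
  assumes S: "endo_field A S" and R: "endo_field A R"
    and s: "\<And>k. k \<in> I \<Longrightarrow> S (E k) = (\<Sum>l\<in>I. s k l \<cdot> E l)"
    and r: "\<And>k. k \<in> I \<Longrightarrow> R (E k) = (\<Sum>l\<in>I. r k l \<cdot> E l)"
    and comm: "\<And>j l. j \<in> I \<Longrightarrow> l \<in> I \<Longrightarrow> (\<Sum>k\<in>I. r j k * s k l) = (\<Sum>k\<in>I. s j k * r k l)"
    and X: "X \<in> vector_fields A"
  shows "S (R X) = R (S X)"
proof (rule endo_field_eqI[OF endo_field_compose[OF S R] endo_field_compose[OF R S] _ X])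
  fix j assume "j \<in> I"
  then show "S (R (E j)) = R (S (E j))"
    using comm[of j]
    by (simp only: s r endo_field_frame_sum[OF S s] endo_field_frame_sum[OF R r] cong: sum.cong)
qed

text \<open>On the frame, being parallel means that the matrix of S commutes with that of each
  \<open>D (E i)\<close>. Tensoriality of \<open>cov_endo\<close> then extends the identity, one
  slot at a time.\<close>

lemma parallel_endo_frame:
  assumes D: "linear_connection A D" and S: "endo_field A S"
    and s: "\<And>k. k \<in> I \<Longrightarrow> S (E k) = (\<Sum>l\<in>I. s k l \<cdot> E l)"
    and d: "\<And>i k. i \<in> I \<Longrightarrow> k \<in> I \<Longrightarrow> D (E i) (E k) = (\<Sum>l\<in>I. d i k l \<cdot> E l)"
    and comm: "\<And>i j l. i \<in> I \<Longrightarrow> j \<in> I \<Longrightarrow> l \<in> I \<Longrightarrow>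
      (\<Sum>k\<in>I. s j k * d i k l) = (\<Sum>k\<in>I. d i j k * s k l)"
    and X: "X \<in> vector_fields A" and Y: "Y \<in> vector_fields A"
  shows "cov_endo D S X Y = 0"
proof -
  have zero: "endo_field A (\<lambda>_. 0)" by (rule endo_fieldI) simp_all
  have "cov_endo D S (E i) (E j) = 0" if i: "i \<in> I" and j: "j \<in> I" for i j
    using comm[OF i j] i j
    by (simp only: cov_endo_def s d endo_field_frame_sum[OF S s] connection_frame_sum[OF D i d[OF i]]
        diff_self cong: sum.cong)
  then have "cov_endo D S (E i) Y = 0" if "i \<in> I" for i
    using endo_field_eqI[OF cov_endo_tensor(2)[OF D S frame_vf[OF that]] zero _ Y] that by blast
  then show ?thesis
    using endo_field_eqI[OF cov_endo_tensor(1)[OF D S Y] zero _ X] by blast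
qed

text \<open>The defect \<open>g (S X) Y + g X (S Y)\<close> is linear over functions in each slot,
  so it is determined by its values on pairs of frame fields.\<close>

lemma skew_frame:
  assumes S: "endo_field A S" and s: "\<And>k. k \<in> I \<Longrightarrow> S (E k) = (\<Sum>l\<in>I. s k l \<cdot> E l)"
    and skew: "\<And>i j. i \<in> I \<Longrightarrow> j \<in> I \<Longrightarrow> s i j * \<epsilon> j + s j i * \<epsilon> i = 0"
    and X: "X \<in> vector_fields A" and Y: "Y \<in> vector_fields A"
  shows "g (S X) Y p = - g X (S Y) p"
proof -
  note vf = endo_field_vf[OF S]
  have "one_form A (\<lambda>X. g (S X) Y + g X (S Y))" if "Y \<in> vector_fields A" for Y
    by (rule one_formI)
      (simp_all add: that vf metric_left metric_right endo_field_add[OF S] endo_field_fscale[OF S]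
        algebra_simps)
  moreover have "one_form A (\<lambda>Y. g (S X) Y + g X (S Y))" if "X \<in> vector_fields A" for X
    by (rule one_formI)
      (simp_all add: that vf metric_left metric_right endo_field_add[OF S] endo_field_fscale[OF S]
        algebra_simps)
  moreover have zero: "one_form A (\<lambda>_. 0)" by (rule one_formI) simp_all
  moreover have "g (S (E i)) (E j) + g (E i) (S (E j)) = 0" if "i \<in> I" "j \<in> I" for i j
  proof
    fix p
    have "g (E i) (S (E j)) p = g (S (E j)) (E i) p" using that by (simp add: metric_sym vf)
    then show "(g (S (E i)) (E j) + g (E i) (S (E j))) p = 0 p"
      using skew[OF that] by (simp only: plus_fun_apply zero_fun_apply s that metric_sum_frame)
  qed
  ultimately have "g (S (E i)) Y + g (E i) (S Y) = 0" if "i \<in> I" for i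
    using one_form_eqI[where S = "\<lambda>Y. g (S (E i)) Y + g (E i) (S Y)", OF _ zero _ Y] that frame_vf by blast
  then have "g (S X) Y + g X (S Y) = 0"
    using one_form_eqI[where S = "\<lambda>X. g (S X) Y + g X (S Y)", OF _ zero _ X]
      \<open>\<And>Y. Y \<in> vector_fields A \<Longrightarrow> one_form A (\<lambda>X. g (S X) Y + g X (S Y))\<close>[OF Y] by blast
  from fun_cong[OF this, of p] show ?thesis by simp
qed

text \<open>The products \<open>g (E j) (E k)\<close> are constant, so the derivative terms of
  Koszul's formula drop out: metric compatibility makes \<open>G i j k\<close> skew in
  \<open>j\<close>, \<open>k\<close>, and vanishing torsion gives its alternation in
  \<open>i\<close>, \<open>j\<close>. Three cyclic instances determine G; the factor
  \<open>\<epsilon> k\<close> in the denominator turns the product with \<open>E k\<close> into a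
  coefficient.\<close>

lemma koszul_frame:
  assumes LC: "levi_civita A g N"
    and c: "\<And>i j. i \<in> I \<Longrightarrow> j \<in> I \<Longrightarrow> bracket (E i) (E j) = (\<Sum>k\<in>I. c i j k \<cdot> E k)"
    and i: "i \<in> I" and j: "j \<in> I"
  shows "N (E i) (E j) =
    (\<Sum>k\<in>I. ((c i j k * \<epsilon> k - c j k i * \<epsilon> i + c k i j * \<epsilon> j) / (2 * \<epsilon> k)) \<cdot> E k)"
proof -
  interpret levi_civita_manifold A g N by unfold_locales fact
  define G where "G i j k p = g (N (E i) (E j)) (E k) p" for i j k p
  have skew: "G i j k p = - G i k j p" if "i \<in> I" "j \<in> I" "k \<in> I" for i j k p
  proof -
    have "dir (E i) (g (E j) (E k)) p = 0" using that by (simp add: frame_metric)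
    then have "g (N (E i) (E j)) (E k) p + g (E j) (N (E i) (E k)) p = 0"
      using metric_compatible[of "E i" "E j" "E k" p] that by simp
    then show ?thesis using that by (simp add: G_def metric_sym[of "E j"])
  qed
  have br: "G i j k p - G j i k p = c i j k * \<epsilon> k" if "i \<in> I" "j \<in> I" "k \<in> I" for i j k p
  proof -
    have "G i j k p - G j i k p = g (bracket (E i) (E j)) (E k) p"
      using that by (simp add: G_def bracket_eq metric_left)
    then show ?thesis using that by (simp only: c metric_sum_frame)
  qed
  show ?thesis
  proof (rule frame_const_coefficients)
    fix k assume k: "k \<in> I"
    have "2 * G i j k p = c i j k * \<epsilon> k - c j k i * \<epsilon> i + c k i j * \<epsilon> j" for p
      using br[OF i j k, of p] br[OF j k i, of p] br[OF k i j, of p]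
        skew[OF i j k, of p] skew[OF j i k, of p] skew[OF k i j, of p] by linarith
    then show "g (N (E i) (E j)) (E k) =
        (\<lambda>_. (c i j k * \<epsilon> k - c j k i * \<epsilon> i + c k i j * \<epsilon> j) / (2 * \<epsilon> k) * \<epsilon> k)"
      using \<epsilon>_nonzero[OF k] by (simp add: G_def fun_eq_iff eq_divide_eq mult.commute)
  qed (simp add: i j)
qed

end

section \<open>Killing Reeb fields and parallel torsion\<close>

text \<open>Collects what Killing's equation yields in any dimension and without a frame. T and D
  are prescribed on vector fields only, whence the membership premises throughout.\<close>

locale killing_B_metric = levi_civita_manifold A g N
  for A :: "('a::topological_space, 'e::euclidean_space) chart set" and g N +
  fixes \<phi> :: "'a vfield \<Rightarrow> 'a vfield" and \<xi> :: "'a vfield" and \<eta> :: "'a vfield \<Rightarrow> 'a \<Rightarrow> real"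
    and D T :: "'a vfield \<Rightarrow> 'a vfield \<Rightarrow> 'a vfield"
  assumes acB: "almost_contact_B_metric A \<phi> \<xi> \<eta> g"
    and T: "\<forall>X\<in>vector_fields A. \<forall>Y\<in>vector_fields A.
              T X Y = 2 \<cdot> (\<eta> X \<odot> N Y \<xi> - \<eta> Y \<odot> N X \<xi> + cov_form N \<eta> X Y \<odot> \<xi>)"
    and D: "\<forall>X\<in>vector_fields A. \<forall>Y\<in>vector_fields A. D X Y = N X Y + (1/2) \<cdot> T X Y"
    and killing: "X \<in> vector_fields A \<Longrightarrow> Y \<in> vector_fields A \<Longrightarrow> g (N X \<xi>) Y p = - g X (N Y \<xi>) p"
begin

abbreviation P :: "'a vfield \<Rightarrow> 'a vfield" where "P X \<equiv> N X \<xi>"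

lemma
  shows \<phi>: "endo_field A \<phi>" and \<xi>_vf [simp]: "\<xi> \<in> vector_fields A" and \<eta>: "one_form A \<eta>"
    and \<phi>\<xi>: "\<phi> \<xi> = 0" and \<eta>\<xi>: "\<eta> \<xi> = 1"
    and \<phi>\<phi>: "X \<in> vector_fields A \<Longrightarrow> \<phi> (\<phi> X) = \<eta> X \<odot> \<xi> - X"
    and \<eta>\<phi>: "X \<in> vector_fields A \<Longrightarrow> \<eta> (\<phi> X) = 0"
    and B_metric: "X \<in> vector_fields A \<Longrightarrow> Y \<in> vector_fields A \<Longrightarrow>
      g (\<phi> X) (\<phi> Y) = \<eta> X * \<eta> Y - g X Y"
  using acB unfolding almost_contact_B_metric_def by blast+

lemmas \<phi>_vf [simp] = endo_field_vf[OF \<phi>]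

lemma \<eta>_smooth [simp]: "X \<in> vector_fields A \<Longrightarrow> \<eta> X \<in> smooth_functions A"
  using \<eta> unfolding one_form_def by blast

lemma P: "endo_field A P"
  by (rule connection_endo[OF connection \<xi>_vf])

text \<open>Put \<open>Y = \<xi>\<close> in the B-metric identity; its left side vanishes by
  \<open>\<phi> \<xi> = 0\<close>.\<close>

lemma \<eta>_metric: "X \<in> vector_fields A \<Longrightarrow> g X \<xi> p = \<eta> X p"
  using fun_cong[OF B_metric[of X \<xi>], of p] by (simp add: \<phi>\<xi> \<eta>\<xi> metric_zero_right)

text \<open>Apply the B-metric identity to X and \<open>\<phi> Y\<close>. In
  \<open>\<phi> (\<phi> Y)\<close> the \<open>\<xi>\<close>-part drops out against
  \<open>\<phi> X\<close>, since \<open>\<eta>\<close> vanishes on the image of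
  \<open>\<phi>\<close>.\<close>

lemma \<phi>_symmetric:
  assumes X: "X \<in> vector_fields A" and Y: "Y \<in> vector_fields A"
  shows "g (\<phi> X) Y p = g X (\<phi> Y) p"
proof -
  have "g (\<phi> X) (\<phi> (\<phi> Y)) p = \<eta> X p * \<eta> (\<phi> Y) p - g X (\<phi> Y) p"
    using B_metric[OF X \<phi>_vf[OF Y]] by simp
  then show ?thesis
    using X Y by (simp add: \<phi>\<phi> \<eta>\<phi> metric_right \<eta>_metric)
qed

text \<open>As \<open>\<xi>\<close> has constant length, every \<open>P Y\<close> is orthogonal to
  it; skewness of P moves this to \<open>P \<xi>\<close>.\<close>

lemma P_Reeb: "P \<xi> = 0"
proof (rule nondegenerate)
  fix Y p assume Y: "Y \<in> vector_fields A"
  have "g \<xi> \<xi> = (\<lambda>_. 1)" by (rule ext) (simp add: \<eta>_metric \<eta>\<xi>)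
  then have "dir Y (g \<xi> \<xi>) p = 0" using Y by simp
  then have "g (P Y) \<xi> p = 0"
    using metric_compatible[OF Y \<xi>_vf \<xi>_vf, of p] metric_sym[of "P Y" \<xi>] Y by simp
  then show "g (P \<xi>) Y p = 0" using killing[OF Y \<xi>_vf] Y by (simp add: metric_sym)
qed simp

lemma \<eta>P: "X \<in> vector_fields A \<Longrightarrow> \<eta> (P X) p = 0"
  using killing[of X \<xi> p] by (simp add: P_Reeb metric_zero_right \<eta>_metric)

lemma cov_form_\<eta>:
  assumes "X \<in> vector_fields A" "Y \<in> vector_fields A"
  shows "cov_form N \<eta> X Y = g (P X) Y"
proof
  fix p
  have "dir X (g Y \<xi>) p = g (N X Y) \<xi> p + g Y (P X) p"
    using assms by (simp add: metric_compatible)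
  moreover have "g Y \<xi> = \<eta> Y" by (rule ext) (simp add: \<eta>_metric assms)
  ultimately show "cov_form N \<eta> X Y p = g (P X) Y p"
    using assms by (simp add: cov_form_def \<eta>_metric metric_sym[of Y])
qed

lemma torsion_tensor:
  assumes "X \<in> vector_fields A" "Y \<in> vector_fields A"
  shows "T X Y = 2 \<cdot> (\<eta> X \<odot> P Y - \<eta> Y \<odot> P X + g (P X) Y \<odot> \<xi>)"
  using T assms by (simp only: cov_form_\<eta>)

lemma T_vf [simp]: "X \<in> vector_fields A \<Longrightarrow> Y \<in> vector_fields A \<Longrightarrow> T X Y \<in> vector_fields A"
  by (simp add: torsion_tensor)

lemma T_skew: "X \<in> vector_fields A \<Longrightarrow> Y \<in> vector_fields A \<Longrightarrow> T Y X p f = - T X Y p f"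
  by (simp add: torsion_tensor killing[of Y] metric_sym[of Y])

lemma T_endo: "X \<in> vector_fields A \<Longrightarrow> endo_field A (T X)"
  by (rule endo_fieldI)
    (simp_all add: torsion_tensor endo_field_add[OF P] endo_field_fscale[OF P] one_form_add[OF \<eta>]
      one_form_fscale[OF \<eta>] metric_right algebra_simps)

lemma T_endo': "Y \<in> vector_fields A \<Longrightarrow> endo_field A (\<lambda>X. T X Y)"
  by (rule endo_fieldI)
    (simp_all add: torsion_tensor endo_field_add[OF P] endo_field_fscale[OF P] one_form_add[OF \<eta>]
      one_form_fscale[OF \<eta>] metric_left algebra_simps)

lemma D_connection: "linear_connection A D"
  by (rule linear_connection_plus_tensor[OF connection T_endo' T_endo])
    (use D in auto)

lemmas D_vf [simp] = connection_vf[OF D_connection]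

lemma D_eq: "X \<in> vector_fields A \<Longrightarrow> Y \<in> vector_fields A \<Longrightarrow>
    D X Y = N X Y + \<eta> X \<odot> P Y - \<eta> Y \<odot> P X + g (P X) Y \<odot> \<xi>"
  by (rule vfield_eqI) (simp add: D torsion_tensor)

lemma T_metric:
  assumes "X \<in> vector_fields A" "Y \<in> vector_fields A" "Z \<in> vector_fields A"
  shows "g (T X Y) Z p = 2 * (\<eta> X p * g (P Y) Z p - \<eta> Y p * g (P X) Z p + g (P X) Y p * \<eta> Z p)"
  using assms by (simp add: torsion_tensor metric_left metric_sym[of \<xi>] \<eta>_metric)

lemma T_metric_skew:
  assumes "X \<in> vector_fields A" "Y \<in> vector_fields A" "Z \<in> vector_fields A"
  shows "g (T X Y) Z p = - g (T X Z) Y p"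
  using assms killing[OF assms(2,3), of p] by (simp add: T_metric metric_sym[of Y])

text \<open>N is torsion-free and T alternates, so the two halves of T add up.\<close>

lemma torsion_D:
  assumes "X \<in> vector_fields A" "Y \<in> vector_fields A"
  shows "torsion D X Y = T X Y"
  unfolding torsion_def bracket_eq[OF assms]
  by (rule vfield_eqI) (simp add: D assms T_skew[OF assms])

text \<open>Half of \<open>T X \<xi>\<close> is \<open>- P X\<close>, which cancels
  \<open>N X \<xi>\<close>.\<close>

lemma D_Reeb: "X \<in> vector_fields A \<Longrightarrow> D X \<xi> = 0"
  by (rule vfield_eqI) (simp add: D_eq P_Reeb \<eta>\<xi> \<eta>_metric \<eta>P)

lemma D_metric:
  assumes "X \<in> vector_fields A" "Y \<in> vector_fields A" "Z \<in> vector_fields A"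
  shows "dir X (g Y Z) p = g (D X Y) Z p + g Y (D X Z) p"
  using assms T_metric_skew[OF assms, of p]
  by (simp add: D metric_left metric_right metric_compatible metric_sym[of Y "T X Z"])

lemma D_\<eta>: "X \<in> vector_fields A \<Longrightarrow> Y \<in> vector_fields A \<Longrightarrow> dir X (\<eta> Y) p = \<eta> (D X Y) p"
proof -
  assume assms: "X \<in> vector_fields A" "Y \<in> vector_fields A"
  have "g Y \<xi> = \<eta> Y" by (rule ext) (simp add: \<eta>_metric assms)
  then show ?thesis
    using D_metric[OF assms \<xi>_vf, of p] assms by (simp add: D_Reeb \<eta>_metric metric_zero_right)
qed

text \<open>The remaining defining conditions come from Killing's equation;
  \<open>D\<phi> = 0\<close> is left to the computation in the frame.\<close>

lemma phiKT:
  assumes "\<And>X Y. X \<in> vector_fields A \<Longrightarrow> Y \<in> vector_fields A \<Longrightarrow> cov_endo D \<phi> X Y = 0"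
  shows "phiKT_connection A \<phi> \<xi> \<eta> g D"
  unfolding phiKT_connection_def Let_def
proof (intro conjI ballI D_connection assms D_Reeb)
  fix X Y assume XY: "X \<in> vector_fields A" "Y \<in> vector_fields A"
  show "cov_form D \<eta> X Y = 0"
    by (rule ext) (simp add: cov_form_def D_\<eta> XY)
  fix Z assume Z: "Z \<in> vector_fields A"
  show "cov_metric D g X Y Z = 0"
    by (rule ext) (simp add: cov_metric_def D_metric XY Z)
  show "g (torsion D X Y) Z = - g (torsion D Y X) Z"
    by (rule ext) (simp add: torsion_D XY Z T_metric killing[of Y] metric_sym[of Y])
  show "g (torsion D X Y) Z = - g (torsion D X Z) Y"
    by (rule ext) (simp add: torsion_D XY Z T_metric_skew[of X Y])
qed

text \<open>\<open>T\<close> is built from \<open>\<eta>\<close>, \<open>g\<close>, \<open>\<xi>\<close>, which are \<open>D\<close>-parallel, and \<open>P\<close>.\<close>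

lemma parallel_torsion:
  assumes DP: "\<And>X Y. X \<in> vector_fields A \<Longrightarrow> Y \<in> vector_fields A \<Longrightarrow> cov_endo D P X Y = 0"
    and X: "X \<in> vector_fields A" and Y: "Y \<in> vector_fields A" and Z: "Z \<in> vector_fields A"
  shows "cov_tensor21 D T X Y Z = 0"
proof -
  have P_eq: "D X (P Y) = P (D X Y)" if "Y \<in> vector_fields A" for Y
    using DP[OF X that] unfolding cov_endo_def by (simp only: eq_iff_diff_eq_0[symmetric])
  note con = connection_cscale[OF D_connection X] connection_add[OF D_connection X]
    connection_diff[OF D_connection X] connection_fscale[OF D_connection X]
  have "D X (T Y Z) = 2 \<cdot> ((dir X (\<eta> Y) \<odot> P Z + \<eta> Y \<odot> P (D X Z))
      - (dir X (\<eta> Z) \<odot> P Y + \<eta> Z \<odot> P (D X Y)) + (dir X (g (P Y) Z) \<odot> \<xi> + g (P Y) Z \<odot> D X \<xi>))"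
    by (simp only: torsion_tensor[OF Y Z] con P_eq X Y Z \<xi>_vf vf_add vf_diff vf_fscale nabla_vf
        \<eta>_smooth smooth_metric)
  then show ?thesis
    unfolding cov_tensor21_def
    by (intro vfield_eqI) (simp add: torsion_tensor X Y Z D_\<eta> D_Reeb D_metric P_eq algebra_simps)
qed

text \<open>Writing \<open>D\<phi> = 0\<close> through N and P expresses the derivative of
  \<open>\<phi>\<close> under N by P alone: the terms with \<open>\<eta> X\<close> cancel because P
  and \<open>\<phi>\<close> commute.\<close>

lemma F_tensor_eq:
  assumes D\<phi>: "\<And>X Y. X \<in> vector_fields A \<Longrightarrow> Y \<in> vector_fields A \<Longrightarrow> cov_endo D \<phi> X Y = 0"
    and P\<phi>: "\<And>X. X \<in> vector_fields A \<Longrightarrow> P (\<phi> X) = \<phi> (P X)"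
    and X: "X \<in> vector_fields A" and Y: "Y \<in> vector_fields A" and Z: "Z \<in> vector_fields A"
  shows "F_tensor \<phi> g N X Y Z p = - g (\<phi> (P X)) Y p * \<eta> Z p - \<eta> Y p * g (\<phi> (P X)) Z p"
proof -
  have "D X (\<phi> Y) = \<phi> (D X Y)"
    using D\<phi>[OF X Y] unfolding cov_endo_def by (simp only: eq_iff_diff_eq_0[symmetric])
  moreover have "\<phi> (D X Y) = \<phi> (N X Y) + \<eta> X \<odot> \<phi> (P Y) - \<eta> Y \<odot> \<phi> (P X) + g (P X) Y \<odot> 0"
    by (simp only: D_eq[OF X Y] endo_field_add[OF \<phi>] endo_field_diff[OF \<phi>] endo_field_fscale[OF \<phi>]
        X Y \<xi>_vf vf_add vf_diff vf_fscale nabla_vf \<eta>_smooth smooth_metric \<phi>\<xi>)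
  moreover have "D X (\<phi> Y) = N X (\<phi> Y) + \<eta> X \<odot> \<phi> (P Y) - 0 \<odot> P X + g (P X) (\<phi> Y) \<odot> \<xi>"
    by (simp only: D_eq[OF X \<phi>_vf[OF Y]] P\<phi>[OF Y] \<eta>\<phi>[OF Y])
  ultimately have eq: "N X (\<phi> Y) + \<eta> X \<odot> \<phi> (P Y) - 0 \<odot> P X + g (P X) (\<phi> Y) \<odot> \<xi>
      = \<phi> (N X Y) + \<eta> X \<odot> \<phi> (P Y) - \<eta> Y \<odot> \<phi> (P X) + g (P X) Y \<odot> 0"
    by simp
  have "cov_endo N \<phi> X Y = - (\<eta> Y \<odot> \<phi> (P X)) - g (P X) (\<phi> Y) \<odot> \<xi>"
  proof (rule vfield_eqI)
    fix p f
    show "cov_endo N \<phi> X Y p f = (- (\<eta> Y \<odot> \<phi> (P X)) - g (P X) (\<phi> Y) \<odot> \<xi>) p f"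
      using fun_cong[OF fun_cong[OF eq], of p f] by (simp add: cov_endo_def)
  qed
  then show ?thesis
    using X Y Z by (simp add: F_tensor_def metric_left metric_sym[of \<xi>] \<eta>_metric \<phi>_symmetric[of "P X" Y])
qed

text \<open>The form \<open>g (\<phi> (P X)) Y\<close> is skew, since P is skew,
  \<open>\<phi>\<close> symmetric and the two commute; hence the six terms of the cyclic sum cancel
  in pairs. Applying \<open>\<phi>\<close> to both arguments changes its sign, and
  \<open>\<eta>\<close> kills the two terms in which it meets \<open>\<phi>\<close>; this gives the
  second identity.\<close>

lemma F7:
  assumes D\<phi>: "\<And>X Y. X \<in> vector_fields A \<Longrightarrow> Y \<in> vector_fields A \<Longrightarrow> cov_endo D \<phi> X Y = 0"
    and P\<phi>: "\<And>X. X \<in> vector_fields A \<Longrightarrow> P (\<phi> X) = \<phi> (P X)"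
  shows "F7_manifold A \<phi> g N"
  unfolding F7_manifold_def Let_def
proof (intro conjI ballI ext)
  note F = F_tensor_eq[OF D\<phi> P\<phi>]
  fix X Y Z p assume v: "X \<in> vector_fields A" "Y \<in> vector_fields A" "Z \<in> vector_fields A"
  have skew: "g (\<phi> (P X)) Y p = - g (\<phi> (P Y)) X p"
    if "X \<in> vector_fields A" "Y \<in> vector_fields A" for X Y
    using killing[OF that(1) \<phi>_vf[OF that(2)], of p] that
    by (simp add: \<phi>_symmetric[of "P X"] P\<phi> metric_sym[of X])
  have invariant: "g (\<phi> (P (\<phi> X))) (\<phi> Y) p = - g (\<phi> (P X)) Y p"
    if "X \<in> vector_fields A" "Y \<in> vector_fields A" for X Y
    using that by (simp add: P\<phi> B_metric \<eta>\<phi>)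
  show "(F_tensor \<phi> g N X Y Z + F_tensor \<phi> g N Y Z X + F_tensor \<phi> g N Z X Y) p = 0 p"
    using v skew[of X Y] skew[of X Z] skew[of Y Z] by (simp add: F)
  show "F_tensor \<phi> g N X Y Z p = (- F_tensor \<phi> g N (\<phi> X) (\<phi> Y) Z - F_tensor \<phi> g N (\<phi> X) Y (\<phi> Z)) p"
    using v invariant[of X Y] invariant[of X Z] by (simp add: F \<eta>\<phi>)
qed

end

section \<open>The five-dimensional example\<close>

theorem proposition22:
  fixes lam1 lam2 lam3 lam4 mu1 mu2 :: real
    and mul :: "'a::{t2_space, second_countable_topology} \<Rightarrow> 'a \<Rightarrow> 'a"
    and one :: 'a and inv :: "'a \<Rightarrow> 'a"
    and A :: "('a, real ^ 5) chart set"
    and E :: "nat \<Rightarrow> 'a vfield"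
    and \<phi> :: "'a vfield \<Rightarrow> 'a vfield" and \<xi> :: "'a vfield"
    and \<eta> :: "'a vfield \<Rightarrow> 'a \<Rightarrow> real"
    and g :: "'a vfield \<Rightarrow> 'a vfield \<Rightarrow> 'a \<Rightarrow> real"
    and N D T :: "'a vfield \<Rightarrow> 'a vfield \<Rightarrow> 'a vfield"
  assumes G: "lie_group mul one inv A"
    and conn: "connected (UNIV :: 'a set)"
    and basis: "real_basis (lie_algebra A mul) {1..5} E"
    and br12: "bracket (E 1) (E 2) = - lam1 \<cdot> E 1 - lam2 \<cdot> E 2 + lam3 \<cdot> E 3 + lam4 \<cdot> E 4 + (2 * mu1) \<cdot> E 5"
    and br34: "- bracket (E 3) (E 4) = - lam1 \<cdot> E 1 - lam2 \<cdot> E 2 + lam3 \<cdot> E 3 + lam4 \<cdot> E 4 + (2 * mu1) \<cdot> E 5"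
    and br14: "bracket (E 1) (E 4) = - lam3 \<cdot> E 1 - lam4 \<cdot> E 2 - lam1 \<cdot> E 3 - lam2 \<cdot> E 4 + (2 * mu2) \<cdot> E 5"
    and br23: "- bracket (E 2) (E 3) = - lam3 \<cdot> E 1 - lam4 \<cdot> E 2 - lam1 \<cdot> E 3 - lam2 \<cdot> E 4 + (2 * mu2) \<cdot> E 5"
    and br0: "bracket (E 1) (E 3) = 0" "bracket (E 2) (E 4) = 0"
             "\<forall>i\<in>{1..4}. bracket (E i) (E 5) = 0"
    and str: "almost_contact_B_metric A \<phi> \<xi> \<eta> g"
    and phi: "\<phi> (E 1) = E 3" "\<phi> (E 2) = E 4" "\<phi> (E 3) = - E 1" "\<phi> (E 4) = - E 2" "\<phi> (E 5) = 0"
    and xi: "\<xi> = E 5"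
    and eta: "\<forall>i\<in>{1..4}. \<eta> (E i) = 0" "\<eta> (E 5) = 1"
    and g: "g (E 1) (E 1) = 1" "g (E 2) (E 2) = 1" "- g (E 3) (E 3) = 1" "- g (E 4) (E 4) = 1"
           "g (E 5) (E 5) = 1" "\<forall>i\<in>{1..5}. \<forall>j\<in>{1..5}. i \<noteq> j \<longrightarrow> g (E i) (E j) = 0"
    and LC: "levi_civita A g N"
    and T: "\<forall>X\<in>vector_fields A. \<forall>Y\<in>vector_fields A.
              T X Y = 2 \<cdot> (\<eta> X \<odot> N Y \<xi> - \<eta> Y \<odot> N X \<xi> + cov_form N \<eta> X Y \<odot> \<xi>)"
    and D: "\<forall>X\<in>vector_fields A. \<forall>Y\<in>vector_fields A. D X Y = N X Y + (1/2) \<cdot> T X Y"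
  shows "F7_manifold A \<phi> g N \<and>
     phiKT_connection A \<phi> \<xi> \<eta> g D \<and>
     (\<forall>X\<in>vector_fields A. \<forall>Y\<in>vector_fields A. torsion D X Y = T X Y) \<and>
     (D (E 1) (E 1) = lam1 \<cdot> E 2 - lam3 \<cdot> E 4 \<and>
       - D (E 3) (E 3) = lam1 \<cdot> E 2 - lam3 \<cdot> E 4 \<and>
       D (E 1) (E 2) = - lam1 \<cdot> E 1 + lam3 \<cdot> E 3 \<and>
       - D (E 3) (E 4) = - lam1 \<cdot> E 1 + lam3 \<cdot> E 3 \<and>
       D (E 1) (E 3) = lam3 \<cdot> E 2 + lam1 \<cdot> E 4 \<and>
       D (E 3) (E 1) = lam3 \<cdot> E 2 + lam1 \<cdot> E 4 \<and>
       D (E 1) (E 4) = - lam3 \<cdot> E 1 - lam1 \<cdot> E 3 \<and>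
       D (E 3) (E 2) = - lam3 \<cdot> E 1 - lam1 \<cdot> E 3 \<and>
       D (E 2) (E 1) = lam2 \<cdot> E 2 - lam4 \<cdot> E 4 \<and>
       - D (E 4) (E 3) = lam2 \<cdot> E 2 - lam4 \<cdot> E 4 \<and>
       D (E 2) (E 2) = - lam2 \<cdot> E 1 + lam4 \<cdot> E 3 \<and>
       - D (E 4) (E 4) = - lam2 \<cdot> E 1 + lam4 \<cdot> E 3 \<and>
       D (E 2) (E 3) = lam4 \<cdot> E 2 + lam2 \<cdot> E 4 \<and>
       D (E 4) (E 1) = lam4 \<cdot> E 2 + lam2 \<cdot> E 4 \<and>
       D (E 2) (E 4) = - lam4 \<cdot> E 1 - lam2 \<cdot> E 3 \<and>
       D (E 4) (E 2) = - lam4 \<cdot> E 1 - lam2 \<cdot> E 3 \<and>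
       D (E 5) (E 1) = - (2 * mu1) \<cdot> E 2 + (2 * mu2) \<cdot> E 4 \<and>
       D (E 5) (E 2) = (2 * mu1) \<cdot> E 1 - (2 * mu2) \<cdot> E 3 \<and>
       D (E 5) (E 3) = - (2 * mu2) \<cdot> E 2 - (2 * mu1) \<cdot> E 4 \<and>
       D (E 5) (E 4) = (2 * mu2) \<cdot> E 1 + (2 * mu1) \<cdot> E 3 \<and>
       (\<forall>i\<in>{1..5}. D (E i) (E 5) = 0)) \<and>
     (\<forall>X\<in>vector_fields A. \<forall>Y\<in>vector_fields A. \<forall>Z\<in>vector_fields A.
        cov_tensor21 D T X Y Z = 0)"
proof -
  interpret lie_group mul one inv A by fact
  define J :: "nat set" where "J = {1..5}"
  have J: "J = {1, 2, 3, 4, 5}" by (auto simp: J_def)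
  note [simp del] = One_nat_def \<comment> \<open>otherwise \<open>E 1\<close> turns into \<open>E (Suc 0)\<close>\<close>
  define \<epsilon> :: "nat \<Rightarrow> real" where "\<epsilon> k = (if k = 3 \<or> k = 4 then - 1 else 1)" for k
  \<comment> \<open>\<open>u\<close> and \<open>w\<close> are the coefficient rows of [E1, E2] and
    [E1, E4]. Their last branch stands for the index 5, as only indices in \<open>J\<close>
    occur.\<close>
  define u where "u k = (if k = 1 then - lam1 else if k = 2 then - lam2 else if k = 3 then lam3
    else if k = 4 then lam4 else 2 * mu1)" for k :: nat
  define w where "w k = (if k = 1 then - lam3 else if k = 2 then - lam4 else if k = 3 then - lam1
    else if k = 4 then - lam2 else 2 * mu2)" for k :: nat
  define c where "c i j k =
    (if (i, j) = (1, 2) \<or> (i, j) = (4, 3) then u k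
     else if (i, j) = (2, 1) \<or> (i, j) = (3, 4) then - u k
     else if (i, j) = (1, 4) \<or> (i, j) = (3, 2) then w k
     else if (i, j) = (4, 1) \<or> (i, j) = (2, 3) then - w k else 0)" for i j k :: nat
  define \<gamma> where "\<gamma> i j k = (c i j k * \<epsilon> k - c j k i * \<epsilon> i + c k i j * \<epsilon> j) / (2 * \<epsilon> k)" for i j k
  define h where "h i = (if i = 5 then 1 else 0 :: real)" for i :: nat
  \<comment> \<open>The coefficient of \<open>E k\<close> in \<open>D_eq\<close> for the fields
    \<open>E i\<close>, \<open>E j\<close>: the row \<open>\<gamma> i 5\<close> belongs to
    \<open>N (E i) \<xi>\<close>, and \<open>h\<close> gives both the values of
    \<open>\<eta>\<close> on the frame and the coordinates of \<open>\<xi>\<close>.\<close>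
  define \<delta> where "\<delta> i j k = \<gamma> i j k + h i * \<gamma> j 5 k - h j * \<gamma> i 5 k + h k * (\<gamma> i 5 j * \<epsilon> j)" for i j k
  define s where "s i k = (if (i, k) = (1, 3) \<or> (i, k) = (2, 4) then 1
     else if (i, k) = (3, 1) \<or> (i, k) = (4, 2) then - 1 else 0 :: real)" for i k :: nat
  have sum5: "sum F J = F 1 + F 2 + F 3 + F 4 + F 5" for F :: "nat \<Rightarrow> 'b::comm_monoid_add"
    unfolding J by (simp add: add.assoc)
  have pm: "pseudo_riemannian A g" using str unfolding almost_contact_B_metric_def by blast
  have gE: "g (E i) (E j) = (\<lambda>_. if i = j then \<epsilon> i else 0)" if "i \<in> J" "j \<in> J" for i j
  proof (cases "i = j")
    case True
    have "g (E 3) (E 3) p = - 1" "g (E 4) (E 4) p = - 1" for p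
      using fun_cong[OF g(3), of p] fun_cong[OF g(4), of p] by simp_all
    then have "g (E i) (E i) p = \<epsilon> i" for p
      using that(1) g unfolding J \<epsilon>_def by auto
    then show ?thesis using True by auto
  next
    case False
    then show ?thesis using g(6) that unfolding J_def by (auto simp: zero_fun_def)
  qed
  have card5: "card J = CARD(5)" by (simp add: J_def)
  have nz: "\<epsilon> i \<noteq> 0" for i by (simp add: \<epsilon>_def)
  have fr: "orthogonal_frame A g J E \<epsilon>"
    by (rule left_invariant_orthogonal_frame[where g = g and \<epsilon> = \<epsilon>, OF G basis[folded J_def] card5 pm gE nz])
  interpret frame: orthogonal_frame A g "J" E \<epsilon>
    by (rule fr)
  interpret LC: levi_civita_manifold A g N by unfold_locales fact
  have bracket_skew: "bracket X Y p f = - bracket Y X p f" for X Y :: "'a vfield" and p f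
    by (simp add: bracket_def)
  \<comment> \<open>Ten brackets are given, some of them up to sign; ten more follow by
    skew-symmetry, and the five diagonal ones vanish.\<close>
  have "\<forall>i\<in>J. \<forall>j\<in>J. \<forall>p f. bracket (E i) (E j) p f = (\<Sum>k\<in>J. c i j k * E k p f)"
  proof -
    have self: "bracket X X p f = 0" for X :: "'a vfield" and p f
      by (simp add: bracket_def)
    have e5: "bracket (E 1) (E 5) = 0" "bracket (E 2) (E 5) = 0" "bracket (E 3) (E 5) = 0"
      "bracket (E 4) (E 5) = 0"
      using br0(3) by simp_all
    note b = br12[THEN fun_cong, THEN fun_cong] br34[THEN fun_cong, THEN fun_cong]
      br14[THEN fun_cong, THEN fun_cong] br23[THEN fun_cong, THEN fun_cong]
      br0(1,2)[THEN fun_cong, THEN fun_cong] e5[THEN fun_cong, THEN fun_cong]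
    have b': "bracket (E 1) (E 2) p f = (\<Sum>k\<in>J. u k * E k p f)"
      "bracket (E 3) (E 4) p f = - (\<Sum>k\<in>J. u k * E k p f)"
      "bracket (E 1) (E 4) p f = (\<Sum>k\<in>J. w k * E k p f)"
      "bracket (E 2) (E 3) p f = - (\<Sum>k\<in>J. w k * E k p f)" for p f
      using b[of p f] by (simp_all add: sum5 u_def w_def)
    note skew = bracket_skew[of "E 2" "E 1"] bracket_skew[of "E 4" "E 3"] bracket_skew[of "E 4" "E 1"]
      bracket_skew[of "E 3" "E 2"] bracket_skew[of "E 3" "E 1"] bracket_skew[of "E 4" "E 2"]
      bracket_skew[of "E 5" "E 1"] bracket_skew[of "E 5" "E 2"] bracket_skew[of "E 5" "E 3"]
      bracket_skew[of "E 5" "E 4"]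
    show ?thesis
      unfolding J ball_simps(5,7)
      by (intro conjI allI ballI)
        (simp_all add: c_def self skew b' e5 br0 sum5)
  qed
  then have br: "bracket (E i) (E j) = (\<Sum>k\<in>J. c i j k \<cdot> E k)" if "i \<in> J" "j \<in> J" for i j
    using that by (intro vfield_eqI) (simp add: sum_fun_apply)
  have N: "N (E i) (E j) = (\<Sum>k\<in>J. \<gamma> i j k \<cdot> E k)" if "i \<in> J" "j \<in> J" for i j
    using frame.koszul_frame[OF LC br that] by (simp only: \<gamma>_def)
  have P: "endo_field A (\<lambda>X. N X \<xi>)"
    by (rule connection_endo[OF LC.connection]) (simp add: xi J)
  have PE: "N (E i) \<xi> = (\<Sum>k\<in>J. \<gamma> i 5 k \<cdot> E k)" if "i \<in> J" for i
    using N[OF that, of 5] by (simp add: xi J)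
  \<comment> \<open>E5 is central, so only its own component in the brackets survives: the product
    \<open>\<gamma> i 5 j * \<epsilon> j\<close> equals \<open>c j i 5 / 2\<close>, which is
    skew.\<close>
  have skew: "\<gamma> i 5 j * \<epsilon> j + \<gamma> j 5 i * \<epsilon> i = 0" if "i \<in> J" "j \<in> J" for i j
    using that unfolding J by (elim insertE emptyE; simp add: \<gamma>_def c_def \<epsilon>_def u_def w_def)
  have killing: "g (N X \<xi>) Y p = - g X (N Y \<xi>) p"
    if "X \<in> vector_fields A" "Y \<in> vector_fields A" for X Y p
    by (rule frame.skew_frame[where S = "\<lambda>X. N X \<xi>" and s = "\<lambda>i. \<gamma> i 5", OF P PE skew that])
  interpret KT: killing_B_metric A g N \<phi> \<xi> \<eta> D T
    by unfold_locales (fact str T D killing)+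
  have \<eta>E: "\<eta> (E i) p = h i" if "i \<in> J" for i p
    using that eta unfolding J h_def by auto
  have DE: "D (E i) (E j) = (\<Sum>k\<in>J. \<delta> i j k \<cdot> E k)" if ij: "i \<in> J" "j \<in> J" for i j
  proof (rule vfield_eqI)
    fix p f
    have "g (N (E i) \<xi>) (E j) p = \<gamma> i 5 j * \<epsilon> j"
      using ij by (simp only: PE frame.metric_sum_frame)
    moreover have "\<xi> p f = (\<Sum>k\<in>J. h k * E k p f)"
      by (simp add: sum5 xi h_def)
    ultimately show "D (E i) (E j) p f = (\<Sum>k\<in>J. \<delta> i j k \<cdot> E k) p f"
      using ij
      by (simp add: KT.D_eq \<eta>E N PE sum_fun_apply \<delta>_def algebra_simps sum.distrib sum_subtractf
          sum_distrib_left)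
  qed
  have \<phi>E: "\<phi> (E i) = (\<Sum>k\<in>J. s i k \<cdot> E k)" if "i \<in> J" for i
    by (rule vfield_eqI) (use that phi in \<open>auto simp: sum5 J s_def\<close>)
  note table = \<delta>_def \<gamma>_def c_def h_def s_def \<epsilon>_def u_def w_def
  have D_expand: "D (E i) (E j) p f =
      \<delta> i j 1 * E 1 p f + \<delta> i j 2 * E 2 p f + \<delta> i j 3 * E 3 p f + \<delta> i j 4 * E 4 p f + \<delta> i j 5 * E 5 p f"
    if "i \<in> J" "j \<in> J" for i j p f
    by (simp only: DE that sum_fun_apply sum5 cscale_apply plus_fun_apply)
  \<comment> \<open>In the frame, \<open>D\<^bsub>E i\<^esub>\<close>, \<open>N _ \<xi>\<close> and \<open>\<phi>\<close> have matrices in the commutative algebra generated by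
    \<open>K\<close>, \<open>L\<close> and the matrix \<open>s\<close> of \<open>\<phi>\<close>.\<close>
  define a where "a i = (if i = 1 then lam1 else if i = 2 then lam2 else if i = 3 then lam3
    else if i = 4 then lam4 else - 2 * mu1)" for i :: nat
  define b where "b i = (if i = 1 then lam3 else if i = 2 then lam4 else if i = 3 then - lam1
    else if i = 4 then - lam2 else - 2 * mu2)" for i :: nat
  \<comment> \<open>With E3 and E4 read as i E1 and i E2, \<open>K\<close> generates the rotations
    of the complex plane with basis E1, E2, and \<open>L\<close> is the endomorphism
    \<open>- \<phi> K\<close>. Thus \<open>a\<close> and \<open>b\<close> are real and imaginary
    parts, up to sign, of one complex factor of \<open>K\<close>.\<close>
  define K where "K i k = (if (i, k) = (1, 2) \<or> (i, k) = (3, 4) then 1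
     else if (i, k) = (2, 1) \<or> (i, k) = (4, 3) then - 1 else 0 :: real)" for i k :: nat
  define L where "L i k = (if (i, k) = (2, 3) \<or> (i, k) = (3, 2) then 1
     else if (i, k) = (1, 4) \<or> (i, k) = (4, 1) then - 1 else 0 :: real)" for i k :: nat
  \<comment> \<open>For \<open>i = 5\<close> centrality of E5 gives N along E5 equal to P, and the
    torsion adds P once more. This is why the values \<open>- 2 * mu1\<close> and
    \<open>- 2 * mu2\<close> of \<open>a 5\<close> and \<open>b 5\<close> are twice the coefficients
    of P.\<close>
  have \<delta>: "\<delta> i j k = a i * K j k + b i * L j k" if "i \<in> J" "j \<in> J" "k \<in> J" for i j k
    using that unfolding J by (elim insertE emptyE; simp add: table a_def b_def K_def L_def)
  have \<gamma>5: "\<gamma> i 5 k = - mu1 * K i k - mu2 * L i k" if "i \<in> J" "k \<in> J" for i k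
    using that unfolding J by (elim insertE emptyE; simp add: table K_def L_def)
  have J5: "1 \<in> J" "2 \<in> J" "3 \<in> J" "4 \<in> J" "5 \<in> J" by (simp_all add: J)
  have s\<gamma>: "(\<Sum>k\<in>J. s j k * \<gamma> k 5 l) = (\<Sum>k\<in>J. \<gamma> j 5 k * s k l)" if "j \<in> J" "l \<in> J" for j l
  proof -
    have "\<forall>j\<in>J. \<forall>l\<in>J. (\<Sum>k\<in>J. s j k * \<gamma> k 5 l) = (\<Sum>k\<in>J. \<gamma> j 5 k * s k l)"
      unfolding sum5 by (simp add: \<gamma>5 J5 cong: ball_cong) (simp add: J K_def L_def s_def)
    then show ?thesis using that by blast
  qed
  have s\<delta>: "(\<Sum>k\<in>J. s j k * \<delta> i k l) = (\<Sum>k\<in>J. \<delta> i j k * s k l)" if "i \<in> J" "j \<in> J" "l \<in> J" for i j l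
  proof -
    have "\<forall>j\<in>J. \<forall>l\<in>J. (\<Sum>k\<in>J. s j k * \<delta> i k l) = (\<Sum>k\<in>J. \<delta> i j k * s k l)"
      unfolding sum5 by (simp add: \<delta> J5 that(1) cong: ball_cong) (simp add: J K_def L_def s_def)
    then show ?thesis using that by blast
  qed
  \<comment> \<open>Both matrices are combinations of \<open>K\<close> and \<open>L\<close>, which
    commute because \<open>K\<close> commutes with \<open>\<phi>\<close>.\<close>
  have \<gamma>\<delta>: "(\<Sum>k\<in>J. \<gamma> j 5 k * \<delta> i k l) = (\<Sum>k\<in>J. \<delta> i j k * \<gamma> k 5 l)"
    if "i \<in> J" "j \<in> J" "l \<in> J" for i j l
  proof -
    have "\<forall>j\<in>J. \<forall>l\<in>J. (\<Sum>k\<in>J. \<gamma> j 5 k * \<delta> i k l) = (\<Sum>k\<in>J. \<delta> i j k * \<gamma> k 5 l)"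
      unfolding sum5 by (simp add: \<delta> \<gamma>5 J5 that(1) cong: ball_cong) (simp add: J K_def L_def algebra_simps)
    then show ?thesis using that by blast
  qed
  have D\<phi>: "cov_endo D \<phi> X Y = 0" if "X \<in> vector_fields A" "Y \<in> vector_fields A" for X Y
    by (rule frame.parallel_endo_frame[where s = s and d = \<delta>, OF KT.D_connection KT.\<phi> \<phi>E DE s\<delta> that])
  have DP: "cov_endo D (\<lambda>X. N X \<xi>) X Y = 0" if "X \<in> vector_fields A" "Y \<in> vector_fields A" for X Y
    by (rule frame.parallel_endo_frame[where S = "\<lambda>X. N X \<xi>" and s = "\<lambda>i. \<gamma> i 5" and d = \<delta>,
          OF KT.D_connection P PE DE \<gamma>\<delta> that])
  have P\<phi>: "N (\<phi> X) \<xi> = \<phi> (N X \<xi>)" if "X \<in> vector_fields A" for X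
    by (rule frame.endo_field_commute_frame[where S = "\<lambda>X. N X \<xi>" and s = "\<lambda>i. \<gamma> i 5" and r = s, OF P KT.\<phi> PE \<phi>E s\<gamma> that])
  have "F7_manifold A \<phi> g N" by (rule KT.F7[OF D\<phi> P\<phi>])
  moreover have "phiKT_connection A \<phi> \<xi> \<eta> g D" by (rule KT.phiKT[OF D\<phi>])
  moreover have "\<forall>X\<in>vector_fields A. \<forall>Y\<in>vector_fields A. torsion D X Y = T X Y"
    by (intro ballI KT.torsion_D)
  moreover have "\<forall>X\<in>vector_fields A. \<forall>Y\<in>vector_fields A. \<forall>Z\<in>vector_fields A. cov_tensor21 D T X Y Z = 0"
    by (intro ballI KT.parallel_torsion DP)
  moreover have "\<forall>i\<in>J. D (E i) (E 5) = 0"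
    using KT.D_Reeb unfolding xi by simp
  ultimately show ?thesis
    unfolding J_def[symmetric]
    by (intro conjI) (assumption | (rule vfield_eqI, simp add: D_expand \<delta> J5 a_def b_def K_def L_def))+
qed

end
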